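(* Let $p$ be an odd prime and let $n,k,t$ be positive integers with $k\ge 2t$. Let $f:\mathbb{Z}_p^n\to\mathbb{Z}_{p^k}$ be defined by $$f(\mathbf{x})=\sum_{i=1}^{k}p^{i-1}a_i(\mathbf{x})=g(\mathbf{x})+p^t h(\mathbf{x})$$ for some functions $a_i:\mathbb{Z}_p^n\to\mathbb{Z}_p$, $1\le i\le k$, where $$g(\mathbf{x})=\sum_{i=1}^{t}p^{i-1}a_i(\mathbf{x})\in\mathcal{GB}_n^{p^t},\qquad h(\mathbf{x})=\sum_{i=1}^{k-t}p^{i-1}a_{t+i}(\mathbf{x})\in\mathcal{GB}_n^{p^{k-t}}.$$ Then $f$ is gbent if and only if for any $\mathbf{u}\in\mathbb{Z}_p^n$ and $c\in\mathbb{Z}_{p^t}$ there exist some $d\in\mathbb{Z}_{p^t}$ and $j\in\mathbb{Z}_{p^{k-t}}$ such that $$\mathcal{H}_{h+cp^{k-2t}g}(\mathbf{u})=\begin{cases}\pm\,\zeta_{p^{k-t}}^{j}\zeta_{p^t}^{cd} & \text{if } n \text{ is even, or } n \text{ is odd and } p\equiv 1 \pmod 4,\\ \pm\sqrt{-1}\,\zeta_{p^{k-t}}^{j}\zeta_{p^t}^{cd} & \text{if } n \text{ is odd and } p\equiv 3 \pmod 4,\end{cases}$$ where $h+cp^{k-2t}g\in\mathcal{GB}_n^{p^{k-t}}$ for every $c\in\mathbb{Z}_{p^t}$, and $j$ and $d$ only depend on $\mathbf{u}$ and $f$.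
   Context: $\mathbb{Z}_m$ is the ring of integers modulo $m$, and $\zeta_m=e^{2\pi\sqrt{-1}/m}$. $\mathcal{GB}_n^{p^r}$ is the set of all functions $\mathbb{Z}_p^n\to\mathbb{Z}_{p^r}$. For $F\in\mathcal{GB}_n^{p^r}$ the generalized Walsh-Hadamard transform is $\mathcal{H}_F(\mathbf{u})=p^{-n/2}\sum_{\mathbf{x}\in\mathbb{Z}_p^n}\zeta_p^{-\mathbf{u}\cdot\mathbf{x}}\zeta_{p^r}^{F(\mathbf{x})}$ for $\mathbf{u}\in\mathbb{Z}_p^n$, where $\mathbf{u}\cdot\mathbf{x}=\sum_i u_ix_i$; $F$ is called gbent if $|\mathcal{H}_F(\mathbf{u})|=1$ for all $\mathbf{u}\in\mathbb{Z}_p^n$. In expansions such as $\sum p^{i-1}a_i(\mathbf{x})$, elements of $\mathbb{Z}_p$ (and of $\mathbb{Z}_{p^r}$) are identified with their representatives in $\{0,\dots,p-1\}$ (resp. $\{0,\dots,p^r-1\}$).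
   Formalization: The sign ± is required, like j and d, to depend only on u and f and not on c; if the sign may vary with c, the "if" direction is false (there is a counterexample with p=3, t=1, k=2, n=4). *)

theory Defs
  imports "HOL-Complex_Analysis.Complex_Analysis" "HOL-Number_Theory.Residues"
begin

text \<open>
  The carrier of \<^const>\<open>residue_ring\<close> is the set of integers from 0 to m - 1, so
  residues are at the same time their canonical integer representatives.
\<close>

abbreviation Zmod :: "nat \<Rightarrow> int set" where
  "Zmod m \<equiv> carrier (residue_ring (int m))"

definition vecs :: "nat \<Rightarrow> nat \<Rightarrow> (nat \<Rightarrow> int) set" where
  "vecs p n = {1..n} \<rightarrow>\<^sub>E Zmod p"

definition dotp :: "nat \<Rightarrow> (nat \<Rightarrow> int) \<Rightarrow> (nat \<Rightarrow> int) \<Rightarrow> int" where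
  "dotp n u x = (\<Sum>i=1..n. u i * x i)"

definition zeta :: "nat \<Rightarrow> complex" where
  "zeta m = exp (2 * complex_of_real pi * \<i> / of_nat m)"

definition GB :: "nat \<Rightarrow> nat \<Rightarrow> nat \<Rightarrow> ((nat \<Rightarrow> int) \<Rightarrow> int) set" where
  "GB p n r = vecs p n \<rightarrow> Zmod (p ^ r)"

text \<open>
  The exponents are integers; no reduction is needed, since the powers of
  \<^term>\<open>zeta m\<close> depend only on the exponent modulo m.
\<close>

definition walsh_hadamard ::
    "nat \<Rightarrow> nat \<Rightarrow> nat \<Rightarrow> ((nat \<Rightarrow> int) \<Rightarrow> int) \<Rightarrow> (nat \<Rightarrow> int) \<Rightarrow> complex" where
  "walsh_hadamard p n r F u =
     complex_of_real (real p powr (- real n / 2)) *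
     (\<Sum>x\<in>vecs p n. zeta p powi (- dotp n u x) * zeta (p ^ r) powi (F x))"

definition gbent :: "nat \<Rightarrow> nat \<Rightarrow> nat \<Rightarrow> ((nat \<Rightarrow> int) \<Rightarrow> int) \<Rightarrow> bool" where
  "gbent p n r F \<longleftrightarrow> F \<in> GB p n r \<and> (\<forall>u\<in>vecs p n. norm (walsh_hadamard p n r F u) = 1)"

lemma mem_Zmod_iff: "x \<in> Zmod m \<longleftrightarrow> 0 \<le> x \<and> x < int m"
  by (auto simp: residue_ring_def)

lemma digit_sum_mem_Zmod:
  assumes "\<And>i. i \<in> {1..m} \<Longrightarrow> b i \<in> Zmod p"
  shows "(\<Sum>i=1..m. int p ^ (i - 1) * b i) \<in> Zmod (p ^ m)"
  using assms
proof (induction m)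
  case 0
  then show ?case by (simp add: residue_ring_def)
next
  case (Suc m)
  let ?s = "\<Sum>i=1..m. int p ^ (i - 1) * b i"
  have s: "0 \<le> ?s" "?s < int p ^ m"
    using Suc.IH Suc.prems unfolding mem_Zmod_iff by auto
  have b: "0 \<le> b (Suc m)" "b (Suc m) \<le> int p - 1"
    using Suc.prems[of "Suc m"] unfolding mem_Zmod_iff by auto
  have "int p ^ m * b (Suc m) \<le> int p ^ m * (int p - 1)"
    using b by (intro mult_left_mono) auto
  then show ?case using s b unfolding mem_Zmod_iff by (simp add: algebra_simps)
qed

lemma digit_sum_split:
  fixes b :: "nat \<Rightarrow> int"
  assumes "t \<le> k"
  shows "(\<Sum>i=1..k. int p ^ (i - 1) * b i) =
    (\<Sum>i=1..t. int p ^ (i - 1) * b i) + int p ^ t * (\<Sum>i=1..k - t. int p ^ (i - 1) * b (t + i))"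
proof -
  obtain m where k: "k = t + m" using assms le_Suc_ex by blast
  have "(\<Sum>i=1..t + m. int p ^ (i - 1) * b i) =
    (\<Sum>i=1..t. int p ^ (i - 1) * b i) + int p ^ t * (\<Sum>i=1..m. int p ^ (i - 1) * b (t + i))"
    by (induction m) (auto simp: power_add algebra_simps)
  then show ?thesis using k by simp
qed

end

theory Submission
  imports Defs "HOL-Computational_Algebra.Polynomial_Factorial"
begin

text \<open>
  Let \<open>z = zeta (p ^ k)\<close>, let \<open>q = p ^ k\<close> and, for a fixed \<open>u\<close>, write \<open>W\<close> for
  the unnormalised transform, the sum of \<open>zeta p powi (- u x) * z powi (f x)\<close> over all
  \<open>x\<close>. It lies in the ring \<open>\<int>[z]\<close>, and gbentness says \<open>W * cnj W = p ^ n\<close>. The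
  proof has two parts: the possible values of such a \<open>W\<close> are found, and then
  the values of \<open>g\<close> are separated by characters.

  The values. Only one prime \<open>1 - z\<close> of \<open>\<int>[z]\<close> lies over \<open>p\<close>, and it is fixed up to units
  by complex conjugation. If \<open>G\<close> is any element of \<open>\<int>[z]\<close> with \<open>G * cnj G = p\<close>, then
  \<open>W * cnj G ^ n\<close> has norm \<open>p ^ (2 * n)\<close> over the real subfield and is hence divisible by
  \<open>p ^ n\<close> (\<open>p_power_dvd_of_norm\<close>). The quotient is an element of
  \<open>\<int>[z]\<close> of absolute value 1, and these are only the numbers \<open>z ^ i\<close> and \<open>- z ^ i\<close>
  (\<open>unit_circle_adjoin\<close>). So \<open>W\<close> is \<open>G ^ n * z ^ i\<close> up to sign
  (\<open>norm_prime_power_element\<close>). For \<open>G\<close> one can take, up to a unit, half of the product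
  of all \<open>1 - zeta p ^ a\<close>, whose square is \<open>p\<close> or \<open>- p\<close> according to \<open>p\<close> modulo 4
  (\<open>half_prod_square\<close>); this is where the factor \<open>\<i>\<close> comes from.

  The separation. The ring \<open>\<int>[z]\<close> admits the automorphisms sending \<open>z\<close> to
  \<open>z ^ (1 + p ^ (k - t) * b)\<close> (\<open>galois_conjugate\<close>). They fix \<open>zeta p\<close> and
  multiply the summand of \<open>x\<close> in \<open>W\<close> by \<open>zeta (p ^ t) powi (b * g x)\<close>,
  while \<open>z ^ i\<close> is multiplied by \<open>zeta (p ^ t) powi (b * i)\<close>. Fourier inversion over \<open>b\<close>
  (\<open>fourier_separation\<close>) shows that the whole sum \<open>W\<close> comes from those \<open>x\<close> for which
  \<open>g x\<close> is the residue \<open>d\<close> of \<open>i\<close> modulo \<open>p ^ t\<close>, the other fibres of \<open>g\<close> contributing 0. The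
  transforms of \<open>h + c * p ^ (k - 2 * t) * g\<close> are obtained from \<open>W\<close> by reweighting the
  fibres of \<open>g\<close>, which gives their values with \<open>j\<close> the quotient of \<open>i\<close> by \<open>p ^ t\<close>.
  The converse is the same inversion, applied to the transforms of
  \<open>h + c * p ^ (k - 2 * t) * g\<close>.

  The automorphisms and the determination of the elements of absolute value 1 rest on the
  irreducibility of the cyclotomic polynomial of order \<open>q\<close>, which is Eisenstein's
  criterion after the shift by 1 (\<open>irreducible_cyclo\<close>).
\<close>

text \<open>
  The unqualified names below stand for the operations on the type of univariate
  polynomials; the record fields of the same names belong to \<open>HOL-Algebra\<close>.
\<close>

hide_const (open) up_ring.monom up_ring.coeff Module.smult

section \<open>Evaluation of integer polynomials at complex numbers\<close>

definition ieval :: "int poly \<Rightarrow> complex \<Rightarrow> complex" where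
  "ieval P z = poly (map_poly of_int P) z"

lemma ieval_0 [simp]: "ieval 0 z = 0"
  by (simp add: ieval_def)

lemma ieval_pCons [simp]: "ieval (pCons a P) z = of_int a + z * ieval P z"
  by (simp add: ieval_def map_poly_pCons)

lemma ieval_1 [simp]: "ieval 1 z = 1"
  by (simp add: one_pCons)

lemma ieval_add [simp]: "ieval (P + Q) z = ieval P z + ieval Q z"
  by (induction P Q rule: poly_induct2) (auto simp: algebra_simps)

lemma ieval_smult [simp]: "ieval (smult c P) z = of_int c * ieval P z"
  by (induction P) (auto simp: algebra_simps)

lemma ieval_uminus [simp]: "ieval (- P) z = - ieval P z"
  using ieval_smult[of "-1" P z] by simp

lemma ieval_diff [simp]: "ieval (P - Q) z = ieval P z - ieval Q z"
  using ieval_add[of P "- Q" z] by simp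

lemma ieval_mult [simp]: "ieval (P * Q) z = ieval P z * ieval Q z"
  by (induction P) (auto simp: algebra_simps)

lemma ieval_power [simp]: "ieval (P ^ n) z = ieval P z ^ n"
  by (induction n) auto

lemma ieval_sum [simp]: "ieval (sum F A) z = (\<Sum>i\<in>A. ieval (F i) z)"
  by (induction A rule: infinite_finite_induct) auto

lemma ieval_monom [simp]: "ieval (monom c n) z = of_int c * z ^ n"
  by (simp add: ieval_def map_poly_monom poly_monom)

lemma ieval_pcompose: "ieval (P \<circ>\<^sub>p Q) z = ieval P (ieval Q z)"
  by (induction P) (auto simp: pcompose_pCons)

lemma ieval_cnj: "cnj (ieval P z) = ieval P (cnj z)"
  by (induction P) auto

section \<open>Irreducibility of cyclotomic polynomials of prime power order\<close>

text \<open>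
  Modulo \<open>q\<close> the product \<open>A * B\<close> has no terms below its leading one, so the
  coefficients of \<open>A\<close> vanish modulo \<open>q\<close> one after the other, as long as the constant
  coefficient of \<open>B\<close> can be cancelled. As the leading coefficient of \<open>A\<close> does not vanish modulo \<open>q\<close>,
  all of the degree is in \<open>A\<close>.
\<close>

lemma eisenstein_factor_unit:
  fixes A B :: "int poly"
  assumes q: "prime_elem q" and lc: "lead_coeff (A * B) = 1"
    and low: "\<And>i. i < degree (A * B) \<Longrightarrow> q dvd coeff (A * B) i"
    and B0: "\<not> q dvd coeff B 0"
  shows "is_unit B"
proof -
  have lcAB: "lead_coeff A * lead_coeff B = 1"
    using lc by (simp add: lead_coeff_mult)
  have nz: "A \<noteq> 0" "B \<noteq> 0" using lcAB by auto
  have dvdA: "q dvd coeff A i" if "i < degree (A * B)" for i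
    using that
  proof (induction i rule: less_induct)
    case (less i)
    have "coeff (A * B) i = (\<Sum>j\<le>i. coeff A j * coeff B (i - j))"
      by (rule coeff_mult)
    also have "\<dots> = (\<Sum>j<i. coeff A j * coeff B (i - j)) + coeff A i * coeff B 0"
      by (simp add: lessThan_Suc_atMost[symmetric])
    finally have eq: "coeff A i * coeff B 0 = coeff (A * B) i - (\<Sum>j<i. coeff A j * coeff B (i - j))"
      by simp
    have "q dvd (\<Sum>j<i. coeff A j * coeff B (i - j))"
      using less by (intro dvd_sum) auto
    with low[OF less.prems] have "q dvd coeff A i * coeff B 0"
      unfolding eq by (rule dvd_diff)
    with B0 q show ?case by (auto simp: prime_elem_dvd_mult_iff)
  qed
  have "\<not> q dvd lead_coeff A"
  proof
    assume "q dvd lead_coeff A"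
    then have "q dvd lead_coeff A * lead_coeff B" by (rule dvd_mult2)
    then show False using lcAB q by (simp add: prime_elem_not_unit)
  qed
  then have "degree (A * B) \<le> degree A" using dvdA by (meson not_less)
  then have "degree B = 0" using nz by (simp add: degree_mult_eq)
  then obtain b where b: "B = [:b:]" by (rule degree_eq_zeroE)
  have "b dvd lead_coeff A * lead_coeff B" unfolding b by simp
  then have "b dvd 1" unfolding lcAB .
  then show ?thesis by (simp only: b is_unit_const_poly_iff)
qed

theorem eisenstein_irreducible:
  fixes F :: "int poly"
  assumes q: "prime_elem q" and lc: "lead_coeff F = 1" and deg: "degree F > 0"
    and low: "\<And>i. i < degree F \<Longrightarrow> q dvd coeff F i"
    and F0: "\<not> q ^ 2 dvd coeff F 0"
  shows "irreducible F"
proof (rule irreducibleI)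
  show "F \<noteq> 0" using deg by auto
  show "\<not> is_unit F" using deg by (auto simp: is_unit_poly_iff)
  fix A B assume F: "F = A * B"
  have "\<not> (q dvd coeff A 0 \<and> q dvd coeff B 0)"
    using F0 by (auto simp: F coeff_mult power2_eq_square mult_dvd_mono)
  then consider "\<not> q dvd coeff B 0" | "\<not> q dvd coeff A 0" by blast
  then show "is_unit A \<or> is_unit B"
  proof cases
    case 1
    then show ?thesis using eisenstein_factor_unit[OF q] lc low unfolding F by blast
  next
    case 2
    have AB: "F = B * A" unfolding F by (rule mult.commute)
    show ?thesis using 2 eisenstein_factor_unit[OF q] lc low unfolding AB by blast
  qed
qed

lemma frobenius_dvd:
  fixes x y :: "'a :: comm_ring_1"
  assumes "prime p"
  shows "of_nat p dvd (x + y) ^ p - x ^ p - y ^ p"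
proof -
  have p: "p > 0" "0 \<noteq> p" using assms prime_gt_0_nat by auto
  have "(x + y) ^ p = (\<Sum>k\<le>p. of_nat (p choose k) * x ^ k * y ^ (p - k))"
    by (rule binomial_ring)
  also have "\<dots> = (\<Sum>k\<in>{0,p}. of_nat (p choose k) * x ^ k * y ^ (p - k)) +
      (\<Sum>k\<in>{..p}-{0,p}. of_nat (p choose k) * x ^ k * y ^ (p - k))"
    by (subst add.commute, rule sum.subset_diff) auto
  finally have "(x + y) ^ p - x ^ p - y ^ p =
      (\<Sum>k\<in>{..p}-{0,p}. of_nat (p choose k) * x ^ k * y ^ (p - k))"
    using p by simp
  also have "of_nat p dvd \<dots>"
  proof (rule dvd_sum)
    fix k assume "k \<in> {..p} - {0, p}"
    then have "p dvd p choose k" using assms by (intro dvd_choose_prime) auto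
    then have "(of_nat p :: 'a) dvd of_nat (p choose k)" by (auto elim!: dvdE)
    then show "of_nat p dvd of_nat (p choose k) * x ^ k * y ^ (p - k)" by simp
  qed
  finally show ?thesis .
qed

text \<open>
  Raising the congruence for \<open>m\<close> to the power \<open>p\<close> keeps it valid modulo \<open>p\<close>, because
  \<open>a - b\<close> divides \<open>a ^ p - b ^ p\<close>.
\<close>

lemma frobenius_power_dvd:
  fixes x :: "'a :: comm_ring_1"
  assumes "prime p"
  shows "of_nat p dvd (x + 1) ^ (p ^ m) - x ^ (p ^ m) - 1"
proof (induction m)
  case (Suc m)
  let ?X = "x ^ (p ^ m)" and ?Y = "(x + 1) ^ (p ^ m)"
  have "?Y - (?X + 1) dvd ?Y ^ p - (?X + 1) ^ p"
    by (simp add: power_diff_sumr2)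
  with Suc have "of_nat p dvd ?Y ^ p - (?X + 1) ^ p"
    by (simp add: diff_diff_eq dvd_trans)
  moreover have "of_nat p dvd (?X + 1) ^ p - ?X ^ p - 1"
    using frobenius_dvd[OF assms, of ?X 1] by simp
  ultimately have "of_nat p dvd (?Y ^ p - (?X + 1) ^ p) + ((?X + 1) ^ p - ?X ^ p - 1)"
    by (rule dvd_add)
  also have "\<dots> = (x + 1) ^ (p ^ Suc m) - x ^ (p ^ Suc m) - 1"
    by (simp add: power_mult[symmetric] mult.commute)
  finally show ?case .
qed auto

text \<open>
  This is the cyclotomic polynomial of order \<open>p ^ Suc m\<close> if \<open>p\<close> is prime.
\<close>

definition cyclo :: "nat \<Rightarrow> nat \<Rightarrow> int poly" where
  "cyclo p m = (\<Sum>i<p. monom 1 (i * p ^ m))"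

lemma ieval_cyclo: "ieval (cyclo p m) z = (\<Sum>i<p. (z ^ (p ^ m)) ^ i)"
  by (simp add: cyclo_def power_mult[symmetric] mult.commute)

lemma poly_cyclo_1: "poly (cyclo p m) 1 = int p"
  by (simp add: cyclo_def poly_sum poly_monom)

text \<open>
  The shifts of a polynomial of degree below \<open>p ^ m\<close> that make up the product do not overlap, so the
  coefficients of the product repeat those of \<open>Q\<close> with period \<open>p ^ m\<close>.
\<close>

lemma coeff_cyclo_mult:
  assumes "p > 0" "degree Q < p ^ m" "i < p ^ Suc m"
  shows "coeff (cyclo p m * Q) i = coeff Q (i mod p ^ m)"
proof -
  let ?n = "p ^ m"
  have n: "?n > 0" using assms by simp
  have s: "i div ?n < p" using assms by (simp add: less_mult_imp_div_less mult.commute)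
  have "coeff (cyclo p m * Q) i = (\<Sum>s<p. coeff (monom 1 (s * ?n) * Q) i)"
    by (simp add: cyclo_def sum_distrib_right coeff_sum)
  also have "\<dots> = (\<Sum>s<p. if s = i div ?n then coeff Q (i mod ?n) else 0)"
  proof (rule sum.cong)
    fix s assume "s \<in> {..<p}"
    show "coeff (monom 1 (s * ?n) * Q) i = (if s = i div ?n then coeff Q (i mod ?n) else 0)"
    proof (cases "s * ?n \<le> i")
      case False
      then have "s \<noteq> i div ?n" by (metis div_times_less_eq_dividend)
      then show ?thesis using False by (simp add: coeff_monom_mult)
    next
      case True
      then have sd: "s \<le> i div ?n" using n by (simp add: less_eq_div_iff_mult_less_eq)
      show ?thesis
      proof (cases "s = i div ?n")
        case True
        have "coeff (monom 1 (s * ?n) * Q) i = coeff Q (i - s * ?n)"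
          using \<open>s * ?n \<le> i\<close> by (simp add: coeff_monom_mult)
        also have "i - s * ?n = i mod ?n" by (simp add: True minus_div_mult_eq_mod)
        finally show ?thesis using True by simp
      next
        case False
        then have "Suc s \<le> i div ?n" using sd by simp
        then have "Suc s * ?n \<le> i" using n less_eq_div_iff_mult_less_eq by blast
        then have "degree Q < i - s * ?n" using assms(2) by simp
        then show ?thesis using False by (auto simp: coeff_monom_mult coeff_eq_0)
      qed
    qed
  qed auto
  also have "\<dots> = coeff Q (i mod ?n)" using s by simp
  finally show ?thesis .
qed

lemma degree_cyclo:
  assumes "p > 0"
  shows "degree (cyclo p m) = (p - 1) * p ^ m" "lead_coeff (cyclo p m) = 1"
proof -
  have c: "coeff (cyclo p m) i = (if \<exists>s<p. i = s * p ^ m then 1 else 0)" for i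
  proof -
    have inj: "s = i div p ^ m" if "i = s * p ^ m" for s
      using that assms by simp
    have "coeff (cyclo p m) i = (\<Sum>s<p. if s * p ^ m = i then 1 else 0)"
      by (simp add: cyclo_def coeff_sum)
    also have "\<dots> = (\<Sum>s<p. if s = i div p ^ m then (if s * p ^ m = i then 1 else 0) else 0)"
      using inj by (intro sum.cong) auto
    also have "\<dots> = (if \<exists>s<p. i = s * p ^ m then 1 else 0)"
      using assms by (auto)
    finally show ?thesis .
  qed
  have "degree (cyclo p m) \<le> (p - 1) * p ^ m"
  proof (rule degree_le, intro allI impI)
    fix i assume i: "(p - 1) * p ^ m < i"
    have "s * p ^ m \<le> (p - 1) * p ^ m" if "s < p" for s
      using that by (intro mult_le_mono1) auto
    then show "coeff (cyclo p m) i = 0" unfolding c using i by fastforce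
  qed
  moreover have c1: "coeff (cyclo p m) ((p - 1) * p ^ m) = 1"
    unfolding c using assms by auto
  ultimately show "degree (cyclo p m) = (p - 1) * p ^ m"
    using le_degree[of "cyclo p m" "(p - 1) * p ^ m"] by simp
  then show "lead_coeff (cyclo p m) = 1" using c1 by simp
qed

text \<open>
  Modulo \<open>p\<close> the Frobenius map turns \<open>(x + 1) ^ p ^ m\<close> into \<open>x ^ p ^ m + 1\<close>, so the
  geometric sum, multiplied by \<open>x ^ p ^ m\<close>, becomes \<open>x ^ p ^ Suc m\<close>.
\<close>

lemma cyclo_shift:
  assumes "prime p"
  shows "\<exists>C. cyclo p m \<circ>\<^sub>p [:1, 1:] = monom 1 ((p - 1) * p ^ m) + smult (int p) C"
proof -
  have p: "p > 0" using assms prime_gt_0_nat by auto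
  define x :: "int poly" where "x = [:0, 1:]"
  let ?c = "of_nat p :: int poly"
  define A where "A = (x + 1) ^ (p ^ m)"
  define S where "S = (\<Sum>i<p. A ^ i)"
  have pc: "monom 1 j \<circ>\<^sub>p [:1, 1:] = (x + 1) ^ j" for j
  proof (induction j)
    case (Suc j)
    have "monom 1 (Suc j) = [:0, 1:] * monom (1::int) j" by (simp add: monom_Suc)
    then show ?case using Suc by (simp add: pcompose_mult pcompose_pCons x_def one_pCons)
  qed (simp add: pcompose_1)
  have S: "cyclo p m \<circ>\<^sub>p [:1, 1:] = S"
    by (simp add: cyclo_def pcompose_sum pc S_def A_def power_mult[symmetric] mult.commute)
  have xn: "x ^ j = monom 1 j" for j
    by (simp add: x_def monom_altdef)
  have AS: "(A - 1) * S = A ^ p - 1"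
    using power_diff_1_eq[of A p] by (simp add: S_def)
  have "?c dvd (A - x ^ (p ^ m) - 1) * S"
    using frobenius_power_dvd[OF assms, of x m] by (simp add: A_def dvd_mult2)
  moreover have "?c dvd A ^ p - (x ^ (p ^ m)) ^ p - 1"
    using frobenius_power_dvd[OF assms, of x "Suc m"]
    by (simp add: A_def power_mult[symmetric] mult.commute)
  ultimately have "?c dvd (A ^ p - (x ^ (p ^ m)) ^ p - 1) - (A - x ^ (p ^ m) - 1) * S"
    by (rule dvd_diff[rotated])
  also have "\<dots> = x ^ (p ^ m) * S - (x ^ (p ^ m)) ^ p"
    using AS by (simp add: algebra_simps)
  also have "(x ^ (p ^ m)) ^ p = x ^ (p ^ m) * x ^ ((p - 1) * p ^ m)"
    using p by (simp add: power_mult[symmetric] power_add[symmetric]) (cases p; simp add: mult.commute)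
  also have "x ^ (p ^ m) * S - x ^ (p ^ m) * x ^ ((p - 1) * p ^ m) =
      monom 1 (p ^ m) * (S - monom 1 ((p - 1) * p ^ m))"
    by (simp add: xn algebra_simps)
  finally have d: "[:int p:] dvd monom 1 (p ^ m) * (S - monom 1 ((p - 1) * p ^ m))"
    by (simp add: of_nat_poly)
  have "[:int p:] dvd S - monom 1 ((p - 1) * p ^ m)"
    unfolding const_poly_dvd_iff
  proof
    fix i
    have "int p dvd coeff (monom 1 (p ^ m) * (S - monom 1 ((p - 1) * p ^ m))) (i + p ^ m)"
      using d unfolding const_poly_dvd_iff by blast
    then show "int p dvd coeff (S - monom 1 ((p - 1) * p ^ m)) i"
      by (simp only: coeff_monom_mult) simp
  qed
  then obtain C where "S - monom 1 ((p - 1) * p ^ m) = [:int p:] * C" by (elim dvdE)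
  then have "S = monom 1 ((p - 1) * p ^ m) + smult (int p) C" by (simp add: algebra_simps)
  with S show ?thesis by auto
qed

theorem irreducible_cyclo:
  assumes p: "prime p"
  shows "irreducible (cyclo p m)"
proof -
  let ?F = "cyclo p m \<circ>\<^sub>p [:1, 1:]"
  let ?d = "(p - 1) * p ^ m"
  have p1: "p > 1" using p prime_gt_1_nat by auto
  then have d0: "?d > 0" by simp
  obtain C where C: "?F = monom 1 ?d + smult (int p) C" using cyclo_shift[OF p] by blast
  have degF: "degree ?F = ?d"
    using degree_cyclo(1)[of p m] p1 by (simp add: degree_pcompose)
  have "lead_coeff ?F = 1" using degree_cyclo(2)[of p m] p1 by (simp add: lead_coeff_comp)
  moreover have "coeff ?F 0 = int p"
    using poly_cyclo_1[of p m] by (simp add: poly_0_coeff_0[symmetric] poly_pcompose)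
  moreover have "int p dvd coeff ?F i" if "i < degree ?F" for i
    using that unfolding degF unfolding C by simp
  moreover have "\<not> int p ^ 2 dvd int p"
    using p1 by (auto simp: power2_eq_square dest!: zdvd_imp_le)
  ultimately have irr: "irreducible ?F"
    using d0 p degF by (intro eisenstein_irreducible[of "int p"]) auto
  show ?thesis
  proof (rule irreducibleI)
    show "cyclo p m \<noteq> 0" using degree_cyclo(2)[of p m] p1 by auto
    show "\<not> is_unit (cyclo p m)"
      using degree_cyclo(1)[of p m] p1 d0 by (auto simp: is_unit_poly_iff)
    fix A B assume "cyclo p m = A * B"
    then have "?F = (A \<circ>\<^sub>p [:1, 1:]) * (B \<circ>\<^sub>p [:1, 1:])" by (simp add: pcompose_mult)
    then have "is_unit (A \<circ>\<^sub>p [:1, 1:]) \<or> is_unit (B \<circ>\<^sub>p [:1, 1:])"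
      using irr irreducibleD by blast
    moreover have "is_unit P" if "is_unit (P \<circ>\<^sub>p [:1, 1:])" for P :: "int poly"
    proof -
      have "degree (P \<circ>\<^sub>p [:1, 1:]) = 0" using that by (auto simp: is_unit_poly_iff)
      then have "degree P = 0" by (simp add: degree_pcompose)
      then obtain a where "P = [:a:]" by (rule degree_eq_zeroE)
      then show ?thesis using that by simp
    qed
    ultimately show "is_unit A \<or> is_unit B" by blast
  qed
qed

section \<open>Integers adjoined a root of unity of prime power order\<close>

text \<open>
  The ring \<open>\<int>[z]\<close>.
\<close>

definition adjoin :: "complex \<Rightarrow> complex set" where
  "adjoin z = range (\<lambda>P. ieval P z)"

lemma ieval_in_adjoin [simp, intro]: "ieval P z \<in> adjoin z"
  by (simp add: adjoin_def)

lemma adjoin_cases: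
  assumes "v \<in> adjoin z"
  obtains P where "v = ieval P z"
  using assms by (auto simp: adjoin_def)

lemma adjoin_mult [simp, intro]:
  assumes "v \<in> adjoin z" "w \<in> adjoin z"
  shows "v * w \<in> adjoin z"
  using assms by (metis adjoin_cases ieval_in_adjoin ieval_mult)

lemma adjoin_add [simp, intro]:
  assumes "v \<in> adjoin z" "w \<in> adjoin z"
  shows "v + w \<in> adjoin z"
  using assms by (metis adjoin_cases ieval_in_adjoin ieval_add)

lemma adjoin_diff [simp, intro]:
  assumes "v \<in> adjoin z" "w \<in> adjoin z"
  shows "v - w \<in> adjoin z"
  using assms by (metis adjoin_cases ieval_in_adjoin ieval_diff)

lemma adjoin_uminus [simp, intro]:
  assumes "v \<in> adjoin z"
  shows "- v \<in> adjoin z"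
  using assms by (metis adjoin_cases ieval_in_adjoin ieval_uminus)

lemma adjoin_of_int [simp, intro]: "of_int c \<in> adjoin z"
  using ieval_in_adjoin[of "[:c:]" z] by simp

lemma adjoin_of_nat [simp, intro]: "of_nat c \<in> adjoin z"
  using adjoin_of_int[of "int c" z] by simp

lemma adjoin_1 [simp, intro]: "1 \<in> adjoin z"
  using adjoin_of_int[of 1 z] by simp

lemma adjoin_self [simp, intro]: "z \<in> adjoin z"
  using ieval_in_adjoin[of "[:0, 1:]" z] by simp

lemma adjoin_power [simp, intro]: "v \<in> adjoin z \<Longrightarrow> v ^ n \<in> adjoin z"
  by (induction n) auto

text \<open>
  The two conditions say that \<open>z\<close> is a primitive root of unity of order \<open>p ^ Suc m\<close>. They
  treat all conjugates of \<open>zeta (p ^ Suc m)\<close> alike, so that every result holds for each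
  of them.
\<close>

locale prime_power_root =
  fixes p m :: nat and z :: complex
  assumes prime: "prime p"
    and root: "z ^ (p ^ Suc m) = 1"
    and primitive: "z ^ (p ^ m) \<noteq> 1"
begin

lemma p_gt_1: "p > 1"
  using prime prime_gt_1_nat by auto

lemma p_pos [simp]: "p > 0" "0 < p ^ j"
  using p_gt_1 by auto

lemma z_nonzero [simp]: "z \<noteq> 0"
  using root p_gt_1 by (auto simp: power_0_left)

lemma norm_z [simp]: "norm z = 1"
proof -
  have "norm z ^ (p ^ Suc m) = 1" using root by (metis norm_one norm_power)
  then show ?thesis using p_pos(2)[of "Suc m"] by (metis norm_ge_zero power_eq_1_iff less_irrefl real_norm_def abs_of_nonneg)
qed

lemma cnj_z: "cnj z = inverse z"
proof -
  have "z * cnj z = 1" using complex_norm_square[of z] by simp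
  then show ?thesis by (metis inverse_unique)
qed

lemma power_mod: "z ^ (i mod p ^ Suc m) = z ^ i"
proof -
  have "z ^ i = z ^ (p ^ Suc m * (i div p ^ Suc m) + i mod p ^ Suc m)" by simp
  also have "\<dots> = z ^ (i mod p ^ Suc m)"
    by (simp only: power_add power_mult root power_one mult_1)
  finally show ?thesis by simp
qed

lemma inverse_z: "inverse z = z ^ (p ^ Suc m - 1)"
proof -
  have "z * z ^ (p ^ Suc m - 1) = 1"
    using root by (metis p_pos(2) power_eq_if less_irrefl)
  then show ?thesis by (metis inverse_unique)
qed

lemma adjoin_cnj [simp, intro]: "v \<in> adjoin z \<Longrightarrow> cnj v \<in> adjoin z"
proof -
  assume "v \<in> adjoin z"
  then obtain P where "v = ieval P z" by (rule adjoin_cases)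
  then have "cnj v = ieval P (cnj z)" by (simp add: ieval_cnj)
  also have "cnj z = ieval (monom 1 (p ^ Suc m - 1)) z" by (simp add: cnj_z inverse_z)
  also have "ieval P \<dots> = ieval (P \<circ>\<^sub>p monom 1 (p ^ Suc m - 1)) z" by (simp only: ieval_pcompose)
  finally show ?thesis by simp
qed

lemma ieval_cyclo_z: "ieval (cyclo p m) z = 0"
proof -
  have "(z ^ (p ^ m) - 1) * (\<Sum>i<p. (z ^ (p ^ m)) ^ i) = (z ^ (p ^ m)) ^ p - 1"
    by (rule power_diff_1_eq[symmetric])
  also have "\<dots> = 0" using root by (simp add: power_mult[symmetric] mult.commute)
  finally show ?thesis using primitive by (simp add: ieval_cyclo)
qed

text \<open>
  A nonzero integer polynomial \<open>M\<close> of least degree among those vanishing at \<open>z\<close> divides, up to a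
  nonzero constant, every other such polynomial. Applied to the cyclotomic polynomial, which is a
  prime element by Gauss's lemma, this shows that the cyclotomic polynomial divides \<open>M\<close> and hence the others.
\<close>

theorem ieval_eq_0_iff: "ieval P z = 0 \<longleftrightarrow> cyclo p m dvd P"
proof
  assume "cyclo p m dvd P"
  then show "ieval P z = 0" by (auto simp: ieval_cyclo_z elim!: dvdE)
next
  assume P: "ieval P z = 0"
  let ?F = "cyclo p m"
  have F: "prime_elem ?F"
    using irreducible_cyclo[OF prime] by (simp add: irreducible_imp_prime_elem)
  have F0: "?F \<noteq> 0" using degree_cyclo(2)[of p m] by auto
  have degF: "degree ?F > 0" using degree_cyclo(1)[of p m] p_gt_1 by simp
  have not_const: "\<not> ?F dvd [:c:]" if "c \<noteq> 0" for c
    using dvd_imp_degree_le[of ?F "[:c:]"] degF that by auto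
  obtain M where M: "M \<noteq> 0" "ieval M z = 0"
    and min: "\<And>N. N \<noteq> 0 \<Longrightarrow> ieval N z = 0 \<Longrightarrow> degree M \<le> degree N"
    using ex_has_least_nat[of "\<lambda>M. M \<noteq> 0 \<and> ieval M z = 0" ?F degree]
      F0 ieval_cyclo_z by blast
  have M_dvd: "\<exists>c. c \<noteq> 0 \<and> M dvd [:c:] * Q" if Q: "ieval Q z = 0" for Q
  proof -
    obtain c S where cS: "c \<noteq> 0" "smult c Q = M * S + pseudo_mod Q M"
      using pseudo_mod(1)[OF M(1)] by blast
    have "ieval (smult c Q) z = ieval (M * S + pseudo_mod Q M) z" by (simp only: cS(2))
    then have "ieval (pseudo_mod Q M) z = 0" using Q M by simp
    then have "pseudo_mod Q M = 0" using pseudo_mod(2)[OF M(1), of Q] min by force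
    then have "[:c:] * Q = M * S" using cS by simp
    then show ?thesis using cS(1) by (metis dvd_triv_left)
  qed
  have "?F dvd M"
  proof -
    obtain c S where c: "c \<noteq> 0" "[:c:] * ?F = M * S"
      using M_dvd[OF ieval_cyclo_z] by (auto elim!: dvdE)
    have "?F dvd M * S" unfolding c(2)[symmetric] by (rule dvd_triv_right)
    then consider "?F dvd M" | "?F dvd S" using F by (auto simp: prime_elem_dvd_mult_iff)
    then show ?thesis
    proof cases
      case 2
      then obtain T where "S = ?F * T" by (elim dvdE)
      then have "[:c:] * ?F = (M * T) * ?F" using c by (simp add: mult_ac)
      then have "[:c:] = M * T" using F0 mult_right_cancel by blast
      then have "degree M = 0" using c(1) by (metis degree_mult_eq add_is_0 degree_pCons_0 mult_eq_0_iff pCons_eq_0_iff)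
      then obtain b where "M = [:b:]" by (rule degree_eq_zeroE)
      then show ?thesis using M by simp
    qed
  qed
  moreover obtain c where "c \<noteq> 0" "M dvd [:c:] * P" using M_dvd[OF P] by blast
  ultimately have "?F dvd [:c:] * P" using dvd_trans by blast
  then show "?F dvd P" using F not_const[OF \<open>c \<noteq> 0\<close>] by (simp only: prime_elem_dvd_mult_iff) simp
qed

text \<open>
  Relations with integer coefficients between powers of \<open>z\<close> are multiples of the
  cyclotomic polynomial and are thus shared by all primitive roots of the same order. In other words,
  \<open>z \<mapsto> y\<close> extends to a ring isomorphism.
\<close>

corollary galois_conjugate:
  assumes "prime_power_root p m y" "ieval P z = ieval Q z"
  shows "ieval P y = ieval Q y"
proof -
  interpret y: prime_power_root p m y by fact
  have "ieval (P - Q) z = 0" using assms(2) by simp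
  then have "ieval (P - Q) y = 0" unfolding ieval_eq_0_iff y.ieval_eq_0_iff .
  then show ?thesis by simp
qed

text \<open>
  The residue ring of \<open>\<int>[z]\<close> at \<open>1 - z\<close> is the field with \<open>p\<close> elements, and the residue of
  the element represented by \<open>P\<close> is the value of \<open>P\<close> at 1: relations between powers of \<open>z\<close> are multiples of the
  cyclotomic polynomial, whose value at 1 is \<open>p\<close>.
\<close>

lemma pi_dvd_iff:
  "(\<exists>v\<in>adjoin z. ieval P z = (1 - z) * v) \<longleftrightarrow> int p dvd poly P 1"
proof
  assume "\<exists>v\<in>adjoin z. ieval P z = (1 - z) * v"
  then obtain Q where "ieval P z = (1 - z) * ieval Q z" by (auto elim!: adjoin_cases)
  then have "ieval (P - [:1, -1:] * Q) z = 0" by (simp add: algebra_simps)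
  then have "cyclo p m dvd P - [:1, -1:] * Q" by (simp only: ieval_eq_0_iff)
  then obtain S where "P - [:1, -1:] * Q = cyclo p m * S" by (elim dvdE)
  then have "poly (P - [:1, -1:] * Q) 1 = poly (cyclo p m * S) 1" by simp
  then show "int p dvd poly P 1" by (simp add: poly_cyclo_1)
next
  have sub: "\<exists>Q. ieval P z = of_int (poly P 1) + (1 - z) * ieval Q z" for P
  proof -
    have "poly (P - [:poly P 1:]) 1 = 0" by simp
    then obtain Q where "P - [:poly P 1:] = [:-1, 1:] * Q" by (simp only: poly_eq_0_iff_dvd) (elim dvdE)
    then have "ieval (P - [:poly P 1:]) z = ieval ([:-1, 1:] * Q) z" by simp
    then have "ieval P z = of_int (poly P 1) + (1 - z) * ieval (- Q) z" by (simp add: algebra_simps)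
    then show ?thesis by blast
  qed
  obtain S where S: "0 = of_nat p + (1 - z) * ieval S z"
    using sub[of "cyclo p m"] by (auto simp: ieval_cyclo_z poly_cyclo_1)
  assume "int p dvd poly P 1"
  then obtain c where c: "poly P 1 = int p * c" by (elim dvdE)
  obtain Q where "ieval P z = of_int (poly P 1) + (1 - z) * ieval Q z" using sub by blast
  also have "of_int (poly P 1) = - (1 - z) * ieval S z * of_int c"
  proof -
    have "of_nat p = - (1 - z) * ieval S z" using S[symmetric] by (simp only: mult_minus_left eq_neg_iff_add_eq_0)
    then show ?thesis by (simp add: c)
  qed
  finally have "ieval P z = (1 - z) * ieval (Q - S * [:c:]) z" by (simp add: algebra_simps)
  then show "\<exists>v\<in>adjoin z. ieval P z = (1 - z) * v" by blast
qed

lemma pi_nonzero: "1 - z \<noteq> 0"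
  using primitive by auto

text \<open>
  The prime \<open>p\<close> is totally ramified: \<open>p\<close> and the power of \<open>1 - z\<close> whose exponent is the degree of
  the cyclotomic polynomial divide each other. Evaluating the shifted cyclotomic polynomial at \<open>z - 1\<close>
  gives \<open>(z - 1) ^ d + p * c = 0\<close> with \<open>c\<close> congruent to 1 modulo \<open>1 - z\<close>; so the exponent of a
  power of \<open>1 - z\<close> that divides \<open>p\<close> can be raised step by step up to \<open>d\<close>.
\<close>

lemma pi_power_dvd_p:
  "\<exists>v\<in>adjoin z. of_nat p = (1 - z) ^ ((p - 1) * p ^ m) * v" (is ?A)
  "\<exists>v\<in>adjoin z. (1 - z) ^ ((p - 1) * p ^ m) = of_nat p * v" (is ?B)
proof -
  let ?d = "(p - 1) * p ^ m"
  obtain C where C: "cyclo p m \<circ>\<^sub>p [:1, 1:] = monom 1 ?d + smult (int p) C"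
    using cyclo_shift[OF prime] by blast
  have d0: "?d > 0" using p_gt_1 by simp
  have "poly (cyclo p m \<circ>\<^sub>p [:1, 1:]) 0 = int p" by (simp add: poly_pcompose poly_cyclo_1)
  then have "poly C 0 = 1" using d0 p_gt_1 by (simp add: C poly_monom power_0_left)
  then obtain D where D: "C = pCons 1 D" by (cases C) auto
  have "ieval (cyclo p m \<circ>\<^sub>p [:1, 1:]) (z - 1) = 0"
    by (simp add: ieval_pcompose ieval_cyclo_z)
  then have "(z - 1) ^ ?d + of_nat p * ieval C (z - 1) = 0" by (simp add: C)
  then have shifted: "(- 1) ^ ?d * (1 - z) ^ ?d + of_nat p * ieval C (z - 1) = 0"
    by (simp flip: power_mult_distrib)
  then have "(- 1) ^ ?d * ((- 1) ^ ?d * (1 - z) ^ ?d + of_nat p * ieval C (z - 1)) = 0" by simp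
  then have eq: "(1 - z) ^ ?d = of_nat p * (- ((- 1) ^ ?d * ieval C (z - 1)))"
    by (simp add: algebra_simps add_eq_0_iff flip: power_mult_distrib)
  have C': "ieval C (z - 1) = ieval (C \<circ>\<^sub>p [:-1, 1:]) z" for C
    by (simp add: ieval_pcompose)
  have "- ((- 1) ^ ?d * ieval C (z - 1)) \<in> adjoin z" unfolding C' by (intro adjoin_uminus adjoin_mult adjoin_power) auto
  with eq show ?B by blast
  have step: "of_nat p = (- ((- 1) ^ ?d)) * (1 - z) ^ ?d + of_nat p * (1 - z) * ieval D (z - 1)"
  proof -
    have "ieval C (z - 1) = 1 + (z - 1) * ieval D (z - 1)" by (simp add: D)
    with shifted have "(- 1) ^ ?d * (1 - z) ^ ?d + of_nat p * (1 + (z - 1) * ieval D (z - 1)) = 0"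
      by simp
    moreover have "n = - e * a + n * (1 - z) * b" if "e * a + n * (1 + (z - 1) * b) = 0" for n e a b
    proof -
      have "n - (- e * a + n * (1 - z) * b) = e * a + n * (1 + (z - 1) * b)"
        by (simp add: algebra_simps)
      then show ?thesis using that by simp
    qed
    ultimately show ?thesis by blast
  qed
  have "\<exists>v\<in>adjoin z. of_nat p = (1 - z) ^ j * v" if "j \<le> ?d" for j
    using that
  proof (induction j)
    case 0
    then show ?case by (intro bexI[of _ "of_nat p"]) auto
  next
    case (Suc j)
    then obtain v where v: "v \<in> adjoin z" "of_nat p = (1 - z) ^ j * v" by auto
    have "of_nat p = (- ((- 1) ^ ?d)) * (1 - z) ^ (Suc j + (?d - Suc j)) + (1 - z) ^ j * v * (1 - z) * ieval D (z - 1)"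
    proof -
      have "Suc j + (?d - Suc j) = ?d" using Suc.prems by simp
      then show ?thesis unfolding v(2)[symmetric] using step by metis
    qed
    also have "\<dots> = (1 - z) ^ Suc j * ((- ((- 1) ^ ?d)) * (1 - z) ^ (?d - Suc j) + v * ieval D (z - 1))"
      by (simp only: power_add) (simp add: algebra_simps)
    finally have "of_nat p = (1 - z) ^ Suc j * ((- ((- 1) ^ ?d)) * (1 - z) ^ (?d - Suc j) + v * ieval D (z - 1))" .
    moreover have "(- ((- 1) ^ ?d)) * (1 - z) ^ (?d - Suc j) + v * ieval D (z - 1) \<in> adjoin z"
      unfolding C' using v(1) by (intro adjoin_add adjoin_mult adjoin_uminus adjoin_power adjoin_diff) auto
    ultimately show ?case by blast
  qed
  then show ?A by blast
qed

lemma pi_dvd_mult: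
  assumes "a \<in> adjoin z" "b \<in> adjoin z" "v \<in> adjoin z" "a * b = (1 - z) * v"
  shows "(\<exists>w\<in>adjoin z. a = (1 - z) * w) \<or> (\<exists>w\<in>adjoin z. b = (1 - z) * w)"
proof -
  obtain P Q where PQ: "a = ieval P z" "b = ieval Q z" using assms by (metis adjoin_cases)
  have "int p dvd poly (P * Q) 1" using assms PQ unfolding pi_dvd_iff[symmetric] by auto
  then have "int p dvd poly P 1 \<or> int p dvd poly Q 1"
    using prime by (simp add: prime_dvd_mult_iff)
  then show ?thesis unfolding PQ pi_dvd_iff by simp
qed

lemma cnj_pi: "cnj (1 - z) = (1 - z) * (- inverse z)"
  by (simp add: cnj_z field_simps)

text \<open>
  Each step removes one factor \<open>1 - z\<close> from \<open>x\<close>. As \<open>1 - z\<close> and its conjugate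
  are associated, the conjugate of \<open>x\<close> loses the same factor, and the product loses two.
\<close>

lemma pi_power_dvd_of_norm:
  assumes "x \<in> adjoin z" "u \<in> adjoin z" "x * cnj x = (1 - z) ^ (2 * N) * u"
  shows "\<exists>y\<in>adjoin z. x = (1 - z) ^ N * y"
  using assms
proof (induction N arbitrary: x u)
  case 0
  then show ?case by auto
next
  case (Suc N)
  have "x * cnj x = (1 - z) * ((1 - z) ^ (2 * N + 1) * u)" using Suc.prems(3) by simp
  then consider w where "w \<in> adjoin z" "x = (1 - z) * w" | w where "w \<in> adjoin z" "cnj x = (1 - z) * w"
    using pi_dvd_mult[of x "cnj x" "(1 - z) ^ (2 * N + 1) * u"] Suc.prems by auto
  then obtain y where y: "y \<in> adjoin z" "x = (1 - z) * y"
  proof cases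
    case 2
    then have "x = cnj ((1 - z) * w)" by (metis complex_cnj_cnj)
    also have "\<dots> = (1 - z) * (- (inverse z) * cnj w)"
      by (simp only: complex_cnj_mult cnj_pi mult.assoc)
    finally show ?thesis using that[of "- (inverse z) * cnj w"] 2(1) by (auto simp: inverse_z)
  qed blast
  have "(1 - z) ^ 2 * (- inverse z * (y * cnj y)) = x * cnj x"
    unfolding y(2) complex_cnj_mult cnj_pi by (simp only: power2_eq_square mult_ac)
  also have "\<dots> = (1 - z) ^ 2 * ((1 - z) ^ (2 * N) * u)"
    unfolding Suc.prems(3) by (simp only: mult.assoc[symmetric] power_add[symmetric]) simp
  finally have norm_y: "- inverse z * (y * cnj y) = (1 - z) ^ (2 * N) * u"
    using pi_nonzero by (subst (asm) mult_cancel_left) simp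
  have "y * cnj y = - z * (- inverse z * (y * cnj y))" by simp
  also have "\<dots> = (1 - z) ^ (2 * N) * (- z * u)" unfolding norm_y by simp
  finally have "y * cnj y = (1 - z) ^ (2 * N) * (- z * u)" .
  then obtain v where "v \<in> adjoin z" "y = (1 - z) ^ N * v"
    using Suc.IH[of y "- z * u"] y(1) Suc.prems(2) by auto
  then show ?case by (intro bexI[of _ v]) (auto simp: y(2))
qed

text \<open>
  There is only one prime over \<open>p\<close>, and it is stable under conjugation, so \<open>x\<close> and its
  conjugate contain it equally often.
\<close>

theorem p_power_dvd_of_norm:
  assumes x: "x \<in> adjoin z" and norm: "x * cnj x = of_nat p ^ (2 * N)"
  shows "\<exists>y\<in>adjoin z. x = of_nat p ^ N * y"
proof -
  let ?d = "(p - 1) * p ^ m"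
  obtain v where v: "v \<in> adjoin z" "of_nat p = (1 - z) ^ ?d * v" using pi_power_dvd_p(1) by blast
  obtain w where w: "w \<in> adjoin z" "(1 - z) ^ ?d = of_nat p * w" using pi_power_dvd_p(2) by blast
  have "x * cnj x = ((1 - z) ^ ?d * v) ^ (2 * N)" using norm v(2) by simp
  also have "\<dots> = (1 - z) ^ (2 * (?d * N)) * v ^ (2 * N)"
    by (simp add: power_mult_distrib power_mult[symmetric] mult_ac)
  finally obtain y where y: "y \<in> adjoin z" "x = (1 - z) ^ (?d * N) * y"
    using pi_power_dvd_of_norm x v(1) by blast
  have "x = of_nat p ^ N * (w ^ N * y)"
    unfolding y(2) power_mult[of _ ?d N] w(2) power_mult_distrib by (rule mult.assoc)
  then show ?thesis using y(1) w(1) by blast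
qed

end

section \<open>Elements of absolute value 1\<close>

lemma sum_sq_diff_eq_0D:
  fixes b :: "'a \<Rightarrow> int"
  assumes S: "finite S" and zero: "(\<Sum>i\<in>S. \<Sum>j\<in>S. (b i - b j) ^ 2) = 0"
    and i: "i \<in> S" and j: "j \<in> S"
  shows "b i = b j"
proof -
  have "(\<Sum>j\<in>S. (b i - b j) ^ 2) = 0"
    using zero i S sum_nonneg_eq_0_iff[of S "\<lambda>i. \<Sum>j\<in>S. (b i - b j) ^ 2"]
    by (simp add: sum_nonneg)
  then have "(b i - b j) ^ 2 = 0"
    using j S sum_nonneg_eq_0_iff[of S "\<lambda>j. (b i - b j) ^ 2"] by simp
  then show ?thesis by simp
qed

text \<open>
  Splitting \<open>S\<close> into a level set of \<open>b\<close> with \<open>r\<close> elements and the rest with \<open>s\<close>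
  elements, the mixed pairs contribute at least \<open>2 * r * s\<close>, which is at least \<open>2 * (r + s - 1)\<close>. In the
  case of equality one part is a singleton, all mixed differences are 1 or -1, and \<open>b\<close> is constant on
  the rest.
\<close>

lemma sum_sq_diff_constant_except_one:
  fixes b :: "'a \<Rightarrow> int"
  assumes S: "finite S" and nonconst: "\<exists>i\<in>S. \<exists>j\<in>S. b i \<noteq> b j"
  defines "T \<equiv> \<Sum>i\<in>S. \<Sum>j\<in>S. (b i - b j) ^ 2"
  shows "T \<ge> 2 * (int (card S) - 1)"
    and "T = 2 * (int (card S) - 1) \<Longrightarrow>
      \<exists>s\<in>S. \<exists>e\<in>{1, -1}. \<exists>v. \<forall>i\<in>S. b i = v + (if i = s then e else 0)"
proof -
  obtain x y where xy: "x \<in> S" "y \<in> S" "b x \<noteq> b y" using nonconst by blast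
  define A where "A = {i\<in>S. b i = b x}"
  define C where "C = {i\<in>S. b i \<noteq> b x}"
  have fin: "finite A" "finite C" "A \<inter> C = {}" "S = A \<union> C"
    using S by (auto simp: A_def C_def)
  have mem: "x \<in> A" "y \<in> C" using xy by (auto simp: A_def C_def)
  then have cards: "card A \<ge> 1" "card C \<ge> 1" using fin by (metis One_nat_def Suc_leI card_gt_0_iff empty_iff)+
  have cardS: "card S = card A + card C" using fin by (simp add: card_Un_disjoint)
  define X where "X = (\<Sum>j\<in>C. (b x - b j) ^ 2)"
  define Y where "Y = (\<Sum>i\<in>C. \<Sum>j\<in>C. (b i - b j) ^ 2)"
  have bA: "b i = b x" if "i \<in> A" for i using that by (simp add: A_def)
  have "T = (\<Sum>i\<in>A. (\<Sum>j\<in>A. (b i - b j) ^ 2) + (\<Sum>j\<in>C. (b i - b j) ^ 2)) +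
      (\<Sum>i\<in>C. (\<Sum>j\<in>A. (b i - b j) ^ 2) + (\<Sum>j\<in>C. (b i - b j) ^ 2))"
    unfolding T_def using fin by (simp add: sum.union_disjoint)
  also have "\<dots> = (\<Sum>i\<in>A. 0 + X) + (\<Sum>i\<in>C. (\<Sum>j\<in>A. (b i - b x) ^ 2) + (\<Sum>j\<in>C. (b i - b j) ^ 2))"
    unfolding X_def by (intro arg_cong2[of _ _ _ _ "(+)"] sum.cong refl) (auto simp: bA)
  also have "\<dots> = int (card A) * X + int (card A) * (\<Sum>i\<in>C. (b i - b x) ^ 2) + Y"
    by (simp add: sum.distrib Y_def sum_distrib_left)
  also have "(\<Sum>i\<in>C. (b i - b x) ^ 2) = X"
    unfolding X_def by (intro sum.cong refl) (simp add: power2_commute)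
  finally have T: "T = 2 * (int (card A) * X) + Y" by simp
  have "(\<Sum>j\<in>C. 1) \<le> X"
    unfolding X_def
  proof (rule sum_mono)
    fix j assume "j \<in> C"
    then have "b x - b j \<noteq> 0" by (auto simp: C_def)
    then have "(b x - b j) ^ 2 > 0" by simp
    then show "1 \<le> (b x - b j) ^ 2" by linarith
  qed
  then have X: "X \<ge> int (card C)" by simp
  have Y: "Y \<ge> 0" unfolding Y_def by (intro sum_nonneg) auto
  have AX: "int (card A) * X \<ge> int (card A) * int (card C)" using X by (intro mult_left_mono) auto
  \<comment> \<open>the excess of the product of the two sizes over their sum minus 1\<close>
  define W where "W = (int (card A) - 1) * (int (card C) - 1)"
  have prod: "int (card A) * int (card C) = W + (int (card S) - 1)"
    by (simp add: W_def cardS algebra_simps)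
  have nn: "W \<ge> 0" using cards by (simp add: W_def)
  define V where "V = int (card A) * X - int (card A) * int (card C)"
  have "V \<ge> 0" using AX by (simp add: V_def)
  have bound: "T = 2 * (int (card S) - 1) + 2 * W + 2 * V + Y"
    unfolding T V_def prod by simp
  show "T \<ge> 2 * (int (card S) - 1)" unfolding bound using \<open>V \<ge> 0\<close> Y nn by simp
  assume eq: "T = 2 * (int (card S) - 1)"
  then have Y0: "Y = 0" and V0: "V = 0" and "W = 0"
    using bound \<open>V \<ge> 0\<close> Y nn by linarith+
  then have one: "card A = 1 \<or> card C = 1" by (auto simp: W_def)
  have X0: "X = int (card C)" using V0 cards by (auto simp: V_def)
  have bC: "b i = b y" if i: "i \<in> C" for i
    using sum_sq_diff_eq_0D[OF fin(2) _ i mem(2)] Y0 by (simp add: Y_def)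
  have "X = int (card C) * (b x - b y) ^ 2"
    unfolding X_def using bC by simp
  then have "(b x - b y) ^ 2 = 1" using X0 cards by simp
  then have d: "b x - b y \<in> {1, -1}" by (auto simp: power2_eq_1_iff)
  from one show "\<exists>s\<in>S. \<exists>e\<in>{1, -1}. \<exists>v. \<forall>i\<in>S. b i = v + (if i = s then e else 0)"
  proof
    assume "card A = 1"
    then have A: "A = {x}" using mem by (metis card_1_singletonE singletonD)
    have "\<forall>i\<in>S. b i = b y + (if i = x then b x - b y else 0)"
      using fin A bC by auto
    then show ?thesis using d xy by blast
  next
    assume "card C = 1"
    then have C: "C = {y}" using mem by (metis card_1_singletonE singletonD)
    have "\<forall>i\<in>S. b i = b x + (if i = y then b y - b x else 0)"
      using fin C bA by auto
    moreover have "b y - b x \<in> {1, -1}" using d by auto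
    ultimately show ?thesis using xy by blast
  qed
qed

lemma bij_betw_add_mod:
  fixes j q :: nat
  assumes "q > 0"
  shows "bij_betw (\<lambda>d. (j + d) mod q) {..<q} {..<q}"
proof -
  have "inj_on (\<lambda>d. (j + d) mod q) {..<q}"
  proof (rule inj_onI)
    fix d e assume "d \<in> {..<q}" "e \<in> {..<q}" "(j + d) mod q = (j + e) mod q"
    then have "[j + d = j + e] (mod q)" by (simp add: unique_euclidean_semiring_class.cong_def)
    then have "[d = e] (mod q)" by (simp add: cong_add_lcancel_nat)
    then show "d = e" using \<open>d \<in> _\<close> \<open>e \<in> _\<close> by (simp add: unique_euclidean_semiring_class.cong_def)
  qed
  moreover have "(\<lambda>d. (j + d) mod q) ` {..<q} \<subseteq> {..<q}" using assms by auto
  ultimately show ?thesis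
    by (simp add: bij_betw_def endo_inj_surj)
qed

lemma sum_add_mod:
  fixes j q :: nat
  assumes "q > 0"
  shows "(\<Sum>d<q. f ((j + d) mod q)) = (\<Sum>i<q. f i)"
  using sum.reindex_bij_betw[OF bij_betw_add_mod[OF assms], of f j] by simp

lemma sum_blocks:
  fixes n p :: nat
  shows "(\<Sum>i<p * n. f i) = (\<Sum>r<n. \<Sum>s<p. f (r + n * s))"
proof -
  have "(\<Sum>i<p * n. f i) = (\<Sum>s<p. \<Sum>i=s*n..<s*n+n. f i)"
    by (rule sum.nat_group[symmetric])
  also have "\<dots> = (\<Sum>s<p. \<Sum>r<n. f (r + n * s))"
  proof (rule sum.cong[OF refl])
    fix s
    show "(\<Sum>i=s*n..<s*n+n. f i) = (\<Sum>r<n. f (r + n * s))"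
      using sum.shift_bounds_nat_ivl[of f 0 "s * n" n]
      by (simp add: atLeast0LessThan add.commute mult.commute)
  qed
  also have "\<dots> = (\<Sum>r<n. \<Sum>s<p. f (r + n * s))" by (rule sum.swap)
  finally show ?thesis .
qed

context prime_power_root
begin

lemma adjoin_coeffs:
  assumes "v \<in> adjoin z"
  obtains c :: "nat \<Rightarrow> int" where "v = (\<Sum>i<p ^ Suc m. of_int (c i) * z ^ i)"
proof -
  let ?q = "p ^ Suc m"
  obtain P where P: "v = ieval P z" using assms by (rule adjoin_cases)
  let ?D = "{..degree P}"
  have "v = (\<Sum>j\<in>?D. of_int (coeff P j) * z ^ j)"
    unfolding P ieval_def
    by (simp add: poly_altdef coeff_map_poly degree_map_poly)
  also have "\<dots> = (\<Sum>i<?q. \<Sum>j\<in>{j\<in>?D. j mod ?q = i}. of_int (coeff P j) * z ^ j)"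
    by (rule sum.group[symmetric]) auto
  also have "\<dots> = (\<Sum>i<?q. of_int (\<Sum>j\<in>{j\<in>?D. j mod ?q = i}. coeff P j) * z ^ i)"
    unfolding of_int_sum sum_distrib_right
  proof (intro sum.cong refl)
    fix i j assume "j \<in> {j\<in>?D. j mod ?q = i}"
    then have "z ^ i = z ^ j" using power_mod[of j] by auto
    then show "of_int (coeff P j) * z ^ j = of_int (coeff P j) * z ^ i" by simp
  qed
  finally show ?thesis by (rule that)
qed

text \<open>
  A multiple of the cyclotomic polynomial of degree less than \<open>p ^ Suc m\<close> has a cofactor of degree less
  than \<open>p ^ m\<close>, so its coefficients are periodic with period \<open>p ^ m\<close>.
\<close>

lemma relation_periodic:
  fixes b :: "nat \<Rightarrow> int"
  assumes "(\<Sum>i<p ^ Suc m. of_int (b i) * z ^ i) = 0"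
    and "i < p ^ Suc m" "j < p ^ Suc m" "i mod p ^ m = j mod p ^ m"
  shows "b i = b j"
proof -
  let ?q = "p ^ Suc m"
  define P where "P = (\<Sum>i<?q. monom (b i) i)"
  have coeffP: "coeff P i = b i" if "i < ?q" for i
    using that by (simp add: P_def coeff_sum)
  have "ieval P z = 0" using assms(1) by (simp add: P_def)
  then obtain Q where Q: "P = cyclo p m * Q" by (auto simp: ieval_eq_0_iff elim!: dvdE)
  have "degree P \<le> ?q - 1"
    unfolding P_def by (intro degree_sum_le) (auto intro: order.trans[OF degree_monom_le])
  then have degP: "degree P < ?q" using p_pos(2)[of "Suc m"] by linarith
  have degQ: "degree Q < p ^ m"
  proof (cases "Q = 0")
    case False
    have "cyclo p m \<noteq> 0" using degree_cyclo(2)[of p m] by auto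
    then have "(p - 1) * p ^ m + degree Q < ?q"
      using degP False by (simp add: Q degree_mult_eq degree_cyclo)
    also have "?q = (p - 1) * p ^ m + p ^ m" using p_pos(1) by (cases p) auto
    finally show ?thesis by simp
  qed simp
  have "b i = coeff Q (i mod p ^ m)" if "i < ?q" for i
    using coeff_cyclo_mult[OF p_pos(1) degQ that] coeffP[OF that] Q by simp
  then show ?thesis using assms by metis
qed

text \<open>
  Let \<open>c\<close> be the coefficients of \<open>y\<close>, indexed cyclically. The relation
  \<open>y * cnj y = 1\<close> says that the autocorrelation of \<open>c\<close>, lowered by 1 at 0,
  is periodic with period \<open>p ^ m\<close>. So the squared differences of \<open>c\<close> and its shift by any nonzero
  multiple of \<open>p ^ m\<close> sum up to 2. Over all these shifts the total is \<open>2 * (p - 1)\<close>,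
  which is the least possible contribution of a single residue class modulo \<open>p ^ m\<close> on which \<open>c\<close> is
  not constant. Thus \<open>c\<close> is constant on all residue classes except for one entry that differs
  by 1 or -1. The constants contribute nothing to \<open>y\<close>, as the powers of \<open>z\<close> along a residue class have sum 0.
\<close>

theorem unit_circle_adjoin:
  assumes y: "y \<in> adjoin z" and norm: "y * cnj y = 1"
  shows "\<exists>e\<in>{1, -1}. \<exists>i<p ^ Suc m. y = e * z ^ i"
proof -
  let ?n = "p ^ m" and ?q = "p ^ Suc m"
  have q: "?q = p * ?n" by simp
  obtain c where c: "y = (\<Sum>i<?q. of_int (c i) * z ^ i)" using adjoin_coeffs[OF y] .
  define ac where "ac d = (\<Sum>j<?q. c ((j + d) mod ?q) * c j)" for d
  have "1 = (\<Sum>j<?q. of_int (c j) * cnj (z ^ j)) * (\<Sum>i<?q. of_int (c i) * z ^ i)"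
    using norm by (simp add: c mult.commute)
  also have "\<dots> = (\<Sum>j<?q. \<Sum>i<?q. of_int (c j) * cnj (z ^ j) * (of_int (c i) * z ^ i))"
    by (rule sum_product)
  also have "\<dots> = (\<Sum>j<?q. \<Sum>d<?q. of_int (c j) * cnj (z ^ j) * (of_int (c ((j + d) mod ?q)) * z ^ ((j + d) mod ?q)))"
    by (intro sum.cong refl sum_add_mod[symmetric]) simp
  also have "\<dots> = (\<Sum>j<?q. \<Sum>d<?q. of_int (c ((j + d) mod ?q) * c j) * z ^ d)"
  proof (intro sum.cong refl)
    fix j d
    have cancel: "cnj (z ^ j) * z ^ ((j + d) mod ?q) = z ^ d"
      unfolding power_mod by (simp add: power_add cnj_z power_inverse field_simps)
    have "of_int (c j) * cnj (z ^ j) * (of_int (c ((j + d) mod ?q)) * z ^ ((j + d) mod ?q)) =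
        of_int (c ((j + d) mod ?q) * c j) * (cnj (z ^ j) * z ^ ((j + d) mod ?q))"
      by (simp only: of_int_mult mult_ac)
    then show "of_int (c j) * cnj (z ^ j) * (of_int (c ((j + d) mod ?q)) * z ^ ((j + d) mod ?q)) =
        of_int (c ((j + d) mod ?q) * c j) * z ^ d"
      unfolding cancel .
  qed
  also have "\<dots> = (\<Sum>d<?q. of_int (ac d) * z ^ d)"
    unfolding ac_def of_int_sum sum_distrib_right by (rule sum.swap)
  finally have ac: "(\<Sum>d<?q. of_int (ac d) * z ^ d) = 1" by simp
  have "(\<Sum>d<?q. of_int (ac d - (if d = 0 then 1 else 0)) * z ^ d) =
      (\<Sum>d<?q. of_int (ac d) * z ^ d) - (\<Sum>d<?q. if d = 0 then 1 else 0)"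
    unfolding sum_subtractf[symmetric] by (intro sum.cong refl) (simp add: algebra_simps)
  also have "\<dots> = 0" using ac p_pos(2)[of "Suc m"] by simp
  finally have per: "(\<Sum>d<?q. of_int (ac d - (if d = 0 then 1 else 0)) * z ^ d) = 0" .
  have ac_shift: "ac (?n * s) = ac 0 - 1" if "0 < s" "s < p" for s
  proof -
    have "?n * s < ?q" using that by simp
    then show ?thesis
      using relation_periodic[OF per, of "?n * s" 0] that by simp
  qed
  have sq: "(\<Sum>j<?q. (c ((j + d) mod ?q) - c j) ^ 2) = 2 * ac 0 - 2 * ac d" for d
  proof -
    have "(\<Sum>j<?q. (c ((j + d) mod ?q) - c j) ^ 2) =
        (\<Sum>j<?q. c ((d + j) mod ?q) ^ 2) + (\<Sum>j<?q. c j ^ 2) - 2 * ac d"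
      unfolding ac_def sum_distrib_left sum.distrib[symmetric] sum_subtractf[symmetric]
      by (intro sum.cong refl) (simp add: power2_eq_square algebra_simps)
    also have "(\<Sum>j<?q. c ((d + j) mod ?q) ^ 2) = (\<Sum>j<?q. c j ^ 2)"
      by (rule sum_add_mod) simp
    finally show ?thesis by (simp add: ac_def power2_eq_square)
  qed
  define b where "b r s = c (r + ?n * s)" for r s
  \<comment> \<open>the contribution of the residue class of r modulo p ^ m\<close>
  define T where "T r = (\<Sum>i<p. \<Sum>j<p. (b r i - b r j) ^ 2)" for r
  have "2 * (int p - 1) = (\<Sum>s<p. if s = 0 then 0 else 2)"
    using p_gt_1 by (subst sum.remove[of _ 0]) (auto simp: of_nat_diff Suc_leI)
  also have "\<dots> = (\<Sum>s<p. 2 * ac 0 - 2 * ac (?n * s))"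
    by (intro sum.cong refl) (auto simp: ac_shift)
  also have "\<dots> = (\<Sum>s<p. \<Sum>r<?n. \<Sum>j<p. (c ((r + ?n * j + ?n * s) mod ?q) - b r j) ^ 2)"
    unfolding sq[symmetric] unfolding q sum_blocks b_def ..
  also have "\<dots> = (\<Sum>r<?n. \<Sum>j<p. \<Sum>s<p. (c ((r + ?n * j + ?n * s) mod ?q) - b r j) ^ 2)"
    by (subst sum.swap, rule sum.cong[OF refl], rule sum.swap)
  also have "\<dots> = (\<Sum>r<?n. \<Sum>j<p. \<Sum>s<p. (b r ((j + s) mod p) - b r j) ^ 2)"
  proof (intro sum.cong refl)
    fix r j s assume "r \<in> {..<?n}"
    then have "(r + ?n * j + ?n * s) mod ?q = r + ?n * ((j + s) mod p)"
      by (simp add: mod_mult2_eq add.assoc mult.commute[of p] flip: distrib_left)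
    then show "(c ((r + ?n * j + ?n * s) mod ?q) - b r j) ^ 2 = (b r ((j + s) mod p) - b r j) ^ 2"
      by (simp add: b_def)
  qed
  also have "\<dots> = (\<Sum>r<?n. T r)"
    unfolding T_def
  proof (rule sum.cong[OF refl], rule sum.cong[OF refl])
    fix r j
    have "(\<Sum>s<p. (b r ((j + s) mod p) - b r j) ^ 2) = (\<Sum>s<p. (b r s - b r j) ^ 2)"
      by (rule sum_add_mod[OF p_pos(1)])
    also have "\<dots> = (\<Sum>s<p. (b r j - b r s) ^ 2)"
      by (intro sum.cong refl power2_commute)
    finally show "(\<Sum>s<p. (b r ((j + s) mod p) - b r j) ^ 2) = (\<Sum>s<p. (b r j - b r s) ^ 2)" .
  qed
  finally have sumT: "(\<Sum>r<?n. T r) = 2 * (int p - 1)" by simp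
  have T_nonneg: "T r \<ge> 0" for r unfolding T_def by (intro sum_nonneg) auto
  have T_const: "b r i = b r j" if "T r = 0" "i < p" "j < p" for r i j
    using sum_sq_diff_eq_0D[of "{..<p}" "b r" i j] that by (simp add: T_def)
  have "\<exists>r<?n. T r \<noteq> 0"
  proof (rule ccontr)
    assume "\<not> ?thesis"
    then have "(\<Sum>r<?n. T r) = 0" by simp
    then show False using sumT p_gt_1 by simp
  qed
  then obtain r0 where r0: "r0 < ?n" "T r0 \<noteq> 0" by blast
  have nonconst: "\<exists>i\<in>{..<p}. \<exists>j\<in>{..<p}. b r0 i \<noteq> b r0 j"
  proof (rule ccontr)
    assume const: "\<not> ?thesis"
    have "T r0 = (\<Sum>i<p. \<Sum>j<p. 0)"
      unfolding T_def
    proof (intro sum.cong refl)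
      fix i j assume "i \<in> {..<p}" "j \<in> {..<p}"
      with const have "b r0 i = b r0 j" by blast
      then show "(b r0 i - b r0 j) ^ 2 = 0" by simp
    qed
    then show False using r0 by simp
  qed
  have split: "T r0 + (\<Sum>r\<in>{..<?n} - {r0}. T r) = 2 * (int p - 1)"
    using sumT r0(1) by (simp add: sum.remove[symmetric])
  have "T r0 \<ge> 2 * (int p - 1)"
    using sum_sq_diff_constant_except_one(1)[OF _ nonconst] by (simp add: T_def)
  moreover have rest_nonneg: "(\<Sum>r\<in>{..<?n} - {r0}. T r) \<ge> 0" by (intro sum_nonneg T_nonneg)
  ultimately have T0: "T r0 = 2 * (int p - 1)" and "(\<Sum>r\<in>{..<?n} - {r0}. T r) = 0"
    using split by linarith+
  then have rest: "T r = 0" if "r < ?n" "r \<noteq> r0" for r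
    using that T_nonneg sum_nonneg_eq_0_iff[of "{..<?n} - {r0}" T] by simp
  obtain s0 e v0 where s0: "s0 < p" "e \<in> {1, -1}"
    and b0: "\<And>s. s < p \<Longrightarrow> b r0 s = v0 + (if s = s0 then e else 0)"
    using sum_sq_diff_constant_except_one(2)[OF _ nonconst] T0 unfolding T_def by fastforce
  \<comment> \<open>the constant of each class; the class of r0 has its exceptional entry at s0\<close>
  define v where "v r = (if r = r0 then v0 else b r 0)" for r
  have b: "b r s = v r + (if r = r0 \<and> s = s0 then e else 0)" if "r < ?n" "s < p" for r s
  proof (cases "r = r0")
    case True
    then show ?thesis using b0[OF that(2)] by (simp add: v_def)
  next
    case False
    then show ?thesis using T_const[OF rest[OF that(1) False] that(2) p_pos(1)] by (simp add: v_def)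
  qed
  have cyc: "(\<Sum>s<p. z ^ (?n * s)) = 0"
    using ieval_cyclo_z by (simp add: ieval_cyclo power_mult)
  have "y = (\<Sum>r<?n. \<Sum>s<p. of_int (b r s) * z ^ (r + ?n * s))"
    unfolding c q sum_blocks b_def ..
  also have "\<dots> = (\<Sum>r<?n. \<Sum>s<p. of_int (v r) * z ^ r * z ^ (?n * s) +
      (if r = r0 then if s = s0 then of_int e * z ^ (r0 + ?n * s0) else 0 else 0))"
    by (intro sum.cong refl) (auto simp: b power_add algebra_simps)
  also have "\<dots> = (\<Sum>r<?n. of_int (v r) * z ^ r * (\<Sum>s<p. z ^ (?n * s))) +
      (\<Sum>r<?n. if r = r0 then of_int e * z ^ (r0 + ?n * s0) else 0)"
    unfolding sum.distrib sum_distrib_left using s0 by (intro arg_cong2[of _ _ _ _ "(+)"] sum.cong refl) auto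
  also have "\<dots> = of_int e * z ^ (r0 + ?n * s0)" using r0 by (simp add: cyc)
  finally have "y = of_int e * z ^ (r0 + ?n * s0)" .
  moreover have "of_int e \<in> {1, -1 :: complex}" using s0(2) by auto
  moreover have "r0 + ?n * s0 < ?q"
  proof -
    have "?n * (s0 + 1) \<le> ?n * p" using s0(1) by (intro mult_le_mono2) simp
    then have "?n * s0 + ?n \<le> ?n * p" by simp
    then show ?thesis using r0(1) by (simp add: mult.commute)
  qed
  ultimately show ?thesis by blast
qed

end

section \<open>Square roots of plus or minus p and elements of norm a power of p\<close>

text \<open>
  For a primitive root of unity \<open>w\<close> of odd prime order \<open>p\<close> this is a square root of \<open>p\<close> or \<open>- p\<close>,
  hence equal to the quadratic Gauss sum up to sign.
\<close>

definition half_prod :: "nat \<Rightarrow> complex \<Rightarrow> complex" where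
  "half_prod p w = (\<Prod>j=1..(p - 1) div 2. w ^ j - w ^ (p - j))"

definition half_prod_poly :: "nat \<Rightarrow> nat \<Rightarrow> int poly" where
  "half_prod_poly p r = (\<Prod>j=1..(p - 1) div 2. monom 1 (r * j) - monom 1 (r * (p - j)))"

lemma ieval_prod [simp]: "ieval (prod F S) z = (\<Prod>i\<in>S. ieval (F i) z)"
  by (induction S rule: infinite_finite_induct) auto

lemma ieval_half_prod_poly: "ieval (half_prod_poly p r) z = half_prod p (z ^ r)"
  by (simp add: half_prod_poly_def half_prod_def power_mult)

context prime_power_root
begin

lemma power_eq_iff:
  assumes "m = 0" "i < p" "j < p"
  shows "z ^ i = z ^ j \<longleftrightarrow> i = j"
proof -
  have zp: "z ^ p = 1" and z1: "z \<noteq> 1" using root primitive assms(1) by auto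
  have ne1: "z ^ d \<noteq> 1" if "0 < d" "d < p" for d
  proof
    assume d: "z ^ d = 1"
    have "coprime d p" using prime that by (metis coprime_commute nat_dvd_not_less prime_imp_coprime)
    then obtain x y where xy: "d * x = Suc (p * y)"
      using bezout_nat[of d p] coprime_bezout_strong[of d p] p_gt_1 by auto
    have "(z ^ d) ^ x = z * (z ^ p) ^ y" by (simp flip: power_mult add: xy)
    then show False using d zp z1 by simp
  qed
  have *: "z ^ i \<noteq> z ^ j" if "i < j" "j < p" for i j
  proof
    assume eq: "z ^ i = z ^ j"
    have "z ^ j = z ^ i * z ^ (j - i)" using that by (simp flip: power_add)
    with eq have "z ^ i * 1 = z ^ i * z ^ (j - i)" by simp
    then have "z ^ (j - i) = 1" by (simp only: mult_cancel_left) (simp add: power_eq_0_iff)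
    then show False using ne1[of "j - i"] that by auto
  qed
  show ?thesis using *[of i j] *[of j i] assms by (metis linorder_neqE_nat)
qed

text \<open>
  The powers of \<open>z\<close> other than 1 are the roots of the cyclotomic polynomial, whose value at 1 is \<open>p\<close>.
\<close>

lemma prod_one_minus_powers:
  assumes m: "m = 0"
  shows "(\<Prod>a=1..p - 1. 1 - z ^ a) = of_nat p"
proof -
  define F :: "complex poly" where "F = map_poly of_int (cyclo p m)"
  define H :: "complex poly" where "H = (\<Prod>a=1..p - 1. [:- (z ^ a), 1:])"
  have degF: "degree F = p - 1" "lead_coeff F = 1"
    using degree_cyclo[of p m] p_pos(1) m by (auto simp: F_def degree_map_poly coeff_map_poly)
  have degH: "degree H = p - 1" "lead_coeff H = 1"
    unfolding H_def by (subst degree_prod_eq_sum_degree) (auto simp: lead_coeff_prod)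
  have inj: "inj_on (\<lambda>a. z ^ a) {1..p - 1}"
    using p_gt_1 by (intro inj_onI) (auto simp: power_eq_iff[OF m])
  have "F = H"
  proof (rule poly_eqI_degree_lead_coeff[where n = "p - 1" and A = "(\<lambda>a. z ^ a) ` {1..p - 1}"])
    show "card ((\<lambda>a. z ^ a) ` {1..p - 1}) \<ge> p - 1" using card_image[OF inj] by simp
    fix x assume "x \<in> (\<lambda>a. z ^ a) ` {1..p - 1}"
    then obtain a where a: "a \<in> {1..p - 1}" "x = z ^ a" by auto
    have "x ^ p = (z ^ p) ^ a" unfolding a(2) by (simp flip: power_mult add: mult.commute)
    then have xp: "x ^ p = 1" using root m by simp
    have "a < p" "a \<noteq> 0" using a(1) p_gt_1 by auto
    then have "x \<noteq> 1" using a(2) power_eq_iff[OF m, of a 0] by auto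
    then interpret x: prime_power_root p m x
      using prime xp m by unfold_locales auto
    have "poly F x = 0" using x.ieval_cyclo_z by (simp add: F_def ieval_def)
    moreover have "poly H x = 0" using a by (auto simp: H_def poly_prod)
    ultimately show "poly F x = poly H x" by simp
  qed (use degF degH in auto)
  then have "poly F 1 = poly H 1" by simp
  moreover have "poly F 1 = of_nat p"
    using ieval_cyclo[of p m 1] by (simp add: F_def ieval_def)
  ultimately show ?thesis by (simp add: H_def poly_prod)
qed

text \<open>
  The square of the factor of \<open>j\<close> is \<open>- (1 - z ^ (2 * j)) * (1 - z ^ (p - 2 * j))\<close>, and the exponents
  \<open>2 * j\<close> and \<open>p - 2 * j\<close> run through the even and the odd numbers between 1 and \<open>p - 1\<close>.
\<close>

theorem half_prod_square:
  assumes m: "m = 0" and odd: "odd p"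
  shows "half_prod p z ^ 2 = (- 1) ^ ((p - 1) div 2) * of_nat p"
proof -
  let ?h = "(p - 1) div 2"
  have p: "p = 2 * ?h + 1" using odd p_pos(1) by (auto elim!: oddE)
  have zp: "z ^ p = 1" using root m by simp
  have "half_prod p z ^ 2 = (\<Prod>j=1..?h. (z ^ j - z ^ (p - j)) ^ 2)"
    by (simp add: half_prod_def prod_power_distrib)
  also have "\<dots> = (\<Prod>j=1..?h. (- 1) * ((1 - z ^ (2 * j)) * (1 - z ^ (p - 2 * j))))"
  proof (rule prod.cong[OF refl])
    fix j assume j: "j \<in> {1..?h}"
    then have j2: "2 * j \<le> p" using p by auto
    have "z ^ j * z ^ (p - j) = 1" "z ^ (2 * j) * z ^ (p - 2 * j) = 1"
      using j2 zp by (simp_all flip: power_add)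
    moreover have "(z ^ (p - j)) ^ 2 = z ^ (p - 2 * j)"
    proof -
      have "(z ^ (p - j)) ^ 2 = z ^ (p + (p - 2 * j))"
        using j2 by (simp flip: power_mult) (intro arg_cong[of _ _ "\<lambda>i. z ^ i"], simp)
      then show ?thesis by (simp add: power_add zp)
    qed
    moreover have "(z ^ j) ^ 2 = z ^ (2 * j)" by (simp flip: power_mult add: mult.commute)
    moreover have "(a - b) ^ 2 = - ((1 - c) * (1 - d))"
      if "a * b = 1" "c * d = 1" "b ^ 2 = d" "a ^ 2 = c" for a b c d :: complex
      using that by (simp add: power2_eq_square algebra_simps)
    ultimately show "(z ^ j - z ^ (p - j)) ^ 2 = (- 1) * ((1 - z ^ (2 * j)) * (1 - z ^ (p - 2 * j)))"
      by simp
  qed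
  also have "\<dots> = (- 1) ^ ?h * ((\<Prod>j=1..?h. 1 - z ^ (2 * j)) * (\<Prod>j=1..?h. 1 - z ^ (p - 2 * j)))"
    by (simp only: prod.distrib prod_constant card_atLeastAtMost) simp
  also have "(\<Prod>j=1..?h. 1 - z ^ (2 * j)) * (\<Prod>j=1..?h. 1 - z ^ (p - 2 * j)) = (\<Prod>a=1..p - 1. 1 - z ^ a)"
  proof -
    have inj: "inj_on (\<lambda>j. 2 * j) {1..?h}" "inj_on (\<lambda>j. p - 2 * j) {1..?h}"
      using p by (auto simp: inj_on_def)
    have ev: "(\<lambda>j. 2 * j) ` {1..?h} = {a\<in>{1..p - 1}. even a}"
      using p by (auto simp: image_iff elim!: evenE)
    have od: "(\<lambda>j. p - 2 * j) ` {1..?h} = {a\<in>{1..p - 1}. odd a}"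
    proof (intro equalityI subsetI)
      fix a assume "a \<in> {a\<in>{1..p - 1}. odd a}"
      then obtain b where "a = 2 * b + 1" "a \<le> p - 1" by (auto elim!: oddE)
      then show "a \<in> (\<lambda>j. p - 2 * j) ` {1..?h}"
        using p by (intro image_eqI[of _ _ "?h - b"]) auto
    qed (use p odd in auto)
    have "(\<Prod>j=1..?h. 1 - z ^ (2 * j)) = (\<Prod>a\<in>{a\<in>{1..p - 1}. even a}. 1 - z ^ a)"
      unfolding ev[symmetric] using inj(1) by (simp add: prod.reindex)
    moreover have "(\<Prod>j=1..?h. 1 - z ^ (p - 2 * j)) = (\<Prod>a\<in>{a\<in>{1..p - 1}. odd a}. 1 - z ^ a)"
      unfolding od[symmetric] using inj(2) by (simp add: prod.reindex)
    moreover have "{1..p - 1} = {a\<in>{1..p - 1}. even a} \<union> {a\<in>{1..p - 1}. odd a}" by auto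
    then have "(\<Prod>a=1..p - 1. 1 - z ^ a) =
        (\<Prod>a\<in>{a\<in>{1..p - 1}. even a}. 1 - z ^ a) * (\<Prod>a\<in>{a\<in>{1..p - 1}. odd a}. 1 - z ^ a)"
      by (metis (no_types, lifting) prod.union_disjoint finite_atLeastAtMost finite_Un disjoint_iff mem_Collect_eq)
    ultimately show ?thesis by simp
  qed
  finally show ?thesis using prod_one_minus_powers[OF m] by simp
qed

text \<open>
  The quotient of \<open>W\<close> by \<open>G ^ n\<close> is \<open>W * cnj G ^ n / p ^ n\<close>. It has absolute value 1 and lies in
  \<open>\<int>[z]\<close> by the divisibility theorem.
\<close>

theorem norm_prime_power_element:
  assumes W: "W \<in> adjoin z" "W * cnj W = of_nat p ^ n"
    and G: "G \<in> adjoin z" "G * cnj G = of_nat p"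
  shows "\<exists>e\<in>{1, -1}. \<exists>i<p ^ Suc m. W = e * G ^ n * z ^ i"
proof -
  have norm: "(W * cnj G ^ n) * cnj (W * cnj G ^ n) = of_nat p ^ (2 * n)"
  proof -
    have "(W * cnj G ^ n) * cnj (W * cnj G ^ n) = (W * cnj W) * (G * cnj G) ^ n"
      by (simp add: power_mult_distrib mult_ac)
    then show ?thesis unfolding W G by (simp add: power_add[symmetric] mult_2)
  qed
  moreover have "W * cnj G ^ n \<in> adjoin z" using W(1) G(1) by auto
  ultimately obtain y where y: "y \<in> adjoin z" "W * cnj G ^ n = of_nat p ^ n * y"
    using p_power_dvd_of_norm by blast
  have "of_nat p ^ (2 * n) * (y * cnj y) = of_nat p ^ (2 * n) * 1"
    using norm unfolding y(2) complex_cnj_mult complex_cnj_power complex_cnj_of_nat mult_2 power_add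
    by (simp add: mult_2 power_add mult_ac)
  then have "y * cnj y = 1" using p_pos(1) by simp
  then obtain e i where e: "e \<in> {1, -1}" "i < p ^ Suc m" "y = e * z ^ i"
    using unit_circle_adjoin[OF y(1)] by blast
  have "of_nat p ^ n * W = W * (G * cnj G) ^ n" by (simp add: G(2))
  also have "\<dots> = W * cnj G ^ n * G ^ n" by (simp add: power_mult_distrib mult_ac)
  also have "\<dots> = of_nat p ^ n * (e * G ^ n * z ^ i)" unfolding y(2) e(3) by (simp add: mult_ac)
  finally have "W = e * G ^ n * z ^ i" using p_pos(1) by simp
  then show ?thesis using e by blast
qed

end

lemma norm_of_square:
  assumes "G ^ 2 = (- 1) ^ j * of_nat p"
  shows "G * cnj G = of_nat p"
proof -
  have "norm G ^ 2 = real p" using assms by (metis mult_1 norm_minus_cancel norm_mult norm_of_nat norm_one norm_power power_one)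
  then show ?thesis by (metis complex_norm_square of_real_of_nat_eq)
qed

lemma normalized_half_prod:
  assumes G: "G ^ 2 = (- 1) ^ ((p - 1) div 2) * of_nat p" and p: "odd p"
  shows "\<exists>s\<in>{1, -1}. complex_of_real (real p powr (- real n / 2)) * G ^ n =
    (if even n \<or> odd n \<and> p mod 4 = 1 then s else s * \<i>)"
proof -
  define r where "r = complex_of_real (sqrt (real p))"
  define \<kappa> where "\<kappa> = (if even ((p - 1) div 2) then 1 else \<i>)"
  have p0: "p > 0" using p by (cases p) auto
  have r: "r ^ 2 = of_nat p" "r \<noteq> 0" using p0 by (auto simp: r_def simp flip: of_real_power)
  have "(r * \<kappa>) ^ 2 = G ^ 2" unfolding G by (simp add: \<kappa>_def power_mult_distrib r)
  then have "G = r * \<kappa> \<or> G = - (r * \<kappa>)" by (auto simp: power2_eq_iff)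
  then have "G = r * (1 * \<kappa>) \<or> G = r * (- 1 * \<kappa>)" by simp
  then obtain s where s: "s \<in> {1, -1}" "G = r * (s * \<kappa>)" by blast
  have "real p powr (- real n / 2) * sqrt (real p) ^ n = 1"
    using p0 by (simp add: powr_half_sqrt[symmetric] powr_powr flip: powr_realpow powr_add)
  then have "complex_of_real (real p powr (- real n / 2)) * r ^ n = 1"
    unfolding r_def by (metis of_real_1 of_real_mult of_real_power)
  then have eq: "complex_of_real (real p powr (- real n / 2)) * G ^ n = (s * \<kappa>) ^ n"
    unfolding s(2) power_mult_distrib[of r "s * \<kappa>"] by (metis mult.assoc mult_1)
  have sn: "s ^ n \<in> {1, -1}" using s(1) by (cases "even n") auto
  have p4: "p mod 4 = 1 \<longleftrightarrow> even ((p - 1) div 2)" using p by presburger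
  show ?thesis
  proof (cases "p mod 4 = 1")
    case True
    then have "(s * \<kappa>) ^ n = s ^ n" using p4 by (simp add: \<kappa>_def)
    then show ?thesis using eq sn True by auto
  next
    case False
    then have k: "\<kappa> = \<i>" using p4 by (simp add: \<kappa>_def)
    show ?thesis
    proof (cases "even n")
      case True
      then obtain l where l: "n = 2 * l" by (elim evenE)
      have "(s * \<kappa>) ^ n = (- 1) ^ l" using s(1) by (auto simp: l k power_mult power_mult_distrib)
      moreover have "(- 1 :: complex) ^ l \<in> {1, -1}" by (cases "even l") auto
      ultimately show ?thesis using eq True by auto
    next
      case odd: False
      then obtain l where l: "n = 2 * l + 1" by (elim oddE)
      have "(s * \<kappa>) ^ n = s * (- 1) ^ l * \<i>" using s(1) by (auto simp: l k power_mult power_mult_distrib)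
      moreover have "s * (- 1 :: complex) ^ l \<in> {1, -1}" using s(1) by (cases "even l") auto
      ultimately show ?thesis using eq odd False by auto
    qed
  qed
qed

section \<open>Characters of the residue ring modulo N\<close>

lemma zeta_power: "zeta N ^ j = exp (2 * of_real pi * \<i> * of_nat j / of_nat N)"
  by (simp add: zeta_def flip: exp_of_nat_mult) (simp add: field_simps)

lemma zeta_nonzero [simp]: "zeta N \<noteq> 0"
  by (simp add: zeta_def)

lemma norm_zeta [simp]: "norm (zeta N) = 1"
proof -
  have "zeta N = exp (\<i> * of_real (2 * pi / real N))" by (simp add: zeta_def field_simps)
  then show ?thesis by (simp only: norm_exp_i_times)
qed

lemma norm_zeta_powi [simp]: "norm (zeta N powi x) = 1"
  by (simp add: norm_power_int)

lemma zeta_power_eq_1_iff: "N > 0 \<Longrightarrow> zeta N ^ j = 1 \<longleftrightarrow> N dvd j"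
  unfolding zeta_power by (intro complex_root_unity_eq_1) simp

lemma zeta_power_self: "N > 0 \<Longrightarrow> zeta N ^ N = 1"
  by (simp add: zeta_power_eq_1_iff)

lemma zeta_mult_power: "a > 0 \<Longrightarrow> zeta (a * b) ^ a = zeta b"
  unfolding zeta_power by (simp add: zeta_def)

lemma zeta_mult_powi: "a > 0 \<Longrightarrow> zeta (a * b) powi (int a * x) = zeta b powi x"
  by (simp add: power_int_mult zeta_mult_power)

lemma zeta_powi_mod:
  assumes "N > 0"
  shows "zeta N powi (x mod int N) = zeta N powi x"
proof -
  have "zeta N powi x = zeta N powi (int N * (x div int N) + x mod int N)" by simp
  also have "\<dots> = zeta N powi (int N * (x div int N)) * zeta N powi (x mod int N)"
    by (rule power_int_add) simp
  also have "zeta N powi (int N * (x div int N)) = 1"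
    using assms by (simp add: power_int_mult zeta_power_self)
  finally show ?thesis by simp
qed

lemma zeta_powi_eq_power: "N > 0 \<Longrightarrow> zeta N powi x = zeta N ^ nat (x mod int N)"
  by (subst zeta_powi_mod[symmetric]) (auto simp: power_int_nonneg_exp)

lemma prime_power_root_zeta:
  assumes "prime p"
  shows "prime_power_root p m (zeta (p ^ Suc m))"
proof
  have p: "p > 1" using assms prime_gt_1_nat by auto
  then have q: "p ^ Suc m > 0" by simp
  show "zeta (p ^ Suc m) ^ p ^ Suc m = 1" by (rule zeta_power_self[OF q])
  have "p ^ m < p ^ Suc m" using p by simp
  then have "\<not> p ^ Suc m dvd p ^ m" using p by (intro nat_dvd_not_less) auto
  then show "zeta (p ^ Suc m) ^ p ^ m \<noteq> 1" by (simp only: zeta_power_eq_1_iff[OF q] not_False_eq_True)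
qed fact

lemma Zmod_eq: "Zmod N = {0..<int N}"
  by (auto simp: mem_Zmod_iff)

lemma zeta_orthogonality:
  assumes N: "N > 0"
  shows "(\<Sum>b\<in>Zmod N. zeta N powi (b * x)) = (if int N dvd x then of_nat N else 0)"
proof -
  let ?y = "zeta N ^ nat (x mod int N)"
  have "(\<Sum>b\<in>Zmod N. zeta N powi (b * x)) = (\<Sum>b<N. ?y ^ b)"
  proof (rule sum.reindex_bij_witness[of _ int nat])
    fix b assume "b \<in> Zmod N"
    then have "b \<ge> 0" by (simp add: mem_Zmod_iff)
    then have "zeta N powi (b * x) = (zeta N powi x) ^ nat b"
      by (metis mult.commute power_int_mult power_int_nonneg_exp)
    then show "?y ^ nat b = zeta N powi (b * x)" by (simp add: zeta_powi_eq_power[OF N])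
  qed (auto simp: mem_Zmod_iff)
  also have "\<dots> = (if int N dvd x then of_nat N else 0)"
  proof (cases "int N dvd x")
    case True
    then show ?thesis by simp
  next
    case False
    then have "\<not> int N dvd int (nat (x mod int N))" using N by (simp add: dvd_mod_iff)
    then have "\<not> N dvd nat (x mod int N)" by (simp only: int_dvd_int_iff not_False_eq_True)
    then have "?y \<noteq> 1" by (simp only: zeta_power_eq_1_iff[OF N] not_False_eq_True)
    moreover have "?y ^ N = 1"
      by (simp only: power_mult[symmetric] zeta_power_eq_1_iff[OF N] dvd_triv_right)
    then have "(?y - 1) * (\<Sum>b<N. ?y ^ b) = 0" by (simp flip: power_diff_1_eq)
    ultimately show ?thesis using False by simp
  qed
  finally show ?thesis .
qed

text \<open>
  By orthogonality of characters the hypothesis determines the sum of \<open>w\<close> over each fibre of \<open>g\<close>: it is \<open>A\<close> on the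
  fibre of \<open>d\<close> and 0 on the others.
\<close>

lemma fourier_separation:
  assumes N: "N > 0" and g: "\<And>x. x \<in> X \<Longrightarrow> g x \<in> Zmod N" and d: "d \<in> Zmod N"
    and eq: "\<And>b. b \<in> Zmod N \<Longrightarrow> (\<Sum>x\<in>X. w x * zeta N powi (b * g x)) = A * zeta N powi (b * d)"
  shows "(\<Sum>x\<in>X. w x * \<phi> (g x)) = A * \<phi> d"
proof -
  have fin: "finite (Zmod N)" by (simp add: Zmod_eq)
  have inv: "of_nat N * \<phi> u = (\<Sum>v\<in>Zmod N. \<phi> v * (\<Sum>b\<in>Zmod N. zeta N powi (b * (u - v))))"
    if "u \<in> Zmod N" for u
  proof -
    have "int N dvd u - v \<longleftrightarrow> v = u" if "v \<in> Zmod N" for v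
      using that \<open>u \<in> Zmod N\<close> by (auto simp: mem_Zmod_iff mod_eq_dvd_iff[symmetric])
    then have "(\<Sum>v\<in>Zmod N. \<phi> v * (\<Sum>b\<in>Zmod N. zeta N powi (b * (u - v)))) =
        (\<Sum>v\<in>Zmod N. if v = u then \<phi> u * of_nat N else 0)"
      by (intro sum.cong refl) (simp add: zeta_orthogonality[OF N])
    then show ?thesis using that fin by simp
  qed
  have split: "zeta N powi (b * (u - v)) = zeta N powi (b * u) * zeta N powi (- b * v)" for b u v
    by (simp flip: power_int_add add: algebra_simps)
  have "of_nat N * (\<Sum>x\<in>X. w x * \<phi> (g x)) = (\<Sum>x\<in>X. w x * (of_nat N * \<phi> (g x)))"
    by (simp add: sum_distrib_left mult_ac)
  also have "\<dots> = (\<Sum>x\<in>X. \<Sum>v\<in>Zmod N. \<Sum>b\<in>Zmod N.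
      \<phi> v * zeta N powi (- b * v) * (w x * zeta N powi (b * g x)))"
    by (intro sum.cong refl) (simp add: inv g split sum_distrib_left mult_ac)
  also have "\<dots> = (\<Sum>v\<in>Zmod N. \<Sum>x\<in>X. \<Sum>b\<in>Zmod N.
      \<phi> v * zeta N powi (- b * v) * (w x * zeta N powi (b * g x)))"
    by (rule sum.swap)
  also have "\<dots> = (\<Sum>v\<in>Zmod N. \<Sum>b\<in>Zmod N. \<Sum>x\<in>X.
      \<phi> v * zeta N powi (- b * v) * (w x * zeta N powi (b * g x)))"
    by (intro sum.cong refl sum.swap)
  also have "\<dots> = (\<Sum>v\<in>Zmod N. \<Sum>b\<in>Zmod N. \<phi> v * zeta N powi (- b * v) * (A * zeta N powi (b * d)))"
    by (intro sum.cong refl) (simp only: sum_distrib_left[symmetric] eq)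
  also have "\<dots> = (\<Sum>v\<in>Zmod N. A * (\<phi> v * (\<Sum>b\<in>Zmod N. zeta N powi (b * (d - v)))))"
    by (intro sum.cong refl) (simp add: split sum_distrib_left mult_ac)
  also have "\<dots> = A * (of_nat N * \<phi> d)"
    by (simp only: inv[OF d] sum_distrib_left[symmetric])
  finally have "of_nat N * (\<Sum>x\<in>X. w x * \<phi> (g x)) = of_nat N * (A * \<phi> d)" by (simp add: mult_ac)
  then show ?thesis using N by simp
qed

section \<open>Character sums of absolute value a power of the square root of p\<close>

text \<open>
  The sum is \<open>G ^ n * z ^ i\<close> up to sign. Applying the automorphism \<open>z \<mapsto> z ^ (1 + p ^ (k - t) * b)\<close> to
  this equation twists it by a character of \<open>g\<close>, and the twisted equations for all \<open>b\<close> allow an arbitrary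
  weight \<open>\<phi>\<close> on the values of \<open>g\<close>.
\<close>

lemma unimodular_walsh_sum:
  fixes e f :: "'x \<Rightarrow> nat" and g :: "'x \<Rightarrow> int"
  assumes p: "prime p" "odd p" and k: "k = Suc m" "t \<le> m"
    and g: "\<And>x. x \<in> X \<Longrightarrow> g x \<in> Zmod (p ^ t)"
    and fg: "\<And>x. x \<in> X \<Longrightarrow> [int (f x) = g x] (mod int (p ^ t))"
  defines "z \<equiv> zeta (p ^ k)" and "G \<equiv> half_prod p (zeta p)"
  assumes norm: "norm (\<Sum>x\<in>X. zeta p ^ e x * z ^ f x) ^ 2 = real p ^ n"
  shows "\<exists>s\<in>{1, -1}. \<exists>i<p ^ k. \<forall>\<phi>.
    (\<Sum>x\<in>X. zeta p ^ e x * z ^ f x * \<phi> (g x)) = s * G ^ n * z ^ i * \<phi> (int i mod int (p ^ t))"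
proof -
  interpret prime_power_root p m z
    unfolding z_def k(1) by (rule prime_power_root_zeta) fact
  have zp: "z ^ (p ^ m) = zeta p"
    using zeta_mult_power[of "p ^ m" p] by (simp add: z_def k(1) mult.commute)
  define P where "P = (\<Sum>x\<in>X. monom (1::int) (p ^ m * e x + f x))"
  have P: "ieval P y = (\<Sum>x\<in>X. (y ^ (p ^ m)) ^ e x * y ^ f x)" for y
    by (simp add: P_def power_add power_mult)
  define W where "W = ieval P z"
  have W: "W = (\<Sum>x\<in>X. zeta p ^ e x * z ^ f x)" by (simp add: W_def P zp)
  have root_p: "prime_power_root p 0 (zeta p)" using prime_power_root_zeta[OF p(1), of 0] by simp
  have "G * cnj G = of_nat p"
    unfolding G_def by (rule norm_of_square, rule prime_power_root.half_prod_square[OF root_p]) (use p in auto)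
  moreover have "G \<in> adjoin z"
    using ieval_in_adjoin[of "half_prod_poly p (p ^ m)" z] by (simp add: ieval_half_prod_poly zp G_def)
  moreover have "W * cnj W = of_nat p ^ n"
  proof -
    have "W * cnj W = of_real (norm W ^ 2)" using complex_norm_square[of W] by simp
    also have "norm W ^ 2 = real p ^ n" unfolding W by (rule norm)
    finally show ?thesis by simp
  qed
  moreover have "W \<in> adjoin z" by (simp add: W_def)
  ultimately obtain s i where s: "s \<in> {1, -1}" and i: "i < p ^ Suc m" "W = s * G ^ n * z ^ i"
    using norm_prime_power_element by blast
  obtain s' :: int where s': "s = of_int s'" using s by (metis insertE of_int_1 of_int_minus singletonD)
  define Q where "Q = smult s' (half_prod_poly p (p ^ m) ^ n * monom 1 i)"
  have PQ: "ieval P z = ieval Q z"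
    using i(2) by (simp add: W_def Q_def s' ieval_half_prod_poly zp G_def mult_ac)
  have twisted: "(\<Sum>x\<in>X. zeta p ^ e x * z ^ f x * zeta (p ^ t) powi (b * g x)) =
      s * G ^ n * z ^ i * zeta (p ^ t) powi (b * (int i mod int (p ^ t)))" if "b \<in> Zmod (p ^ t)" for b
  proof -
    define b' where "b' = nat b"
    have b: "b = int b'" using that unfolding b'_def mem_Zmod_iff by simp
    \<comment> \<open>the image of z under the automorphism; its p ^ m-th power is again zeta p\<close>
    define y where "y = z ^ (1 + p ^ (k - t) * b')"
    have zk: "z ^ (p ^ (k - t)) = zeta (p ^ t)"
    proof -
      have "p ^ k = p ^ (k - t) * p ^ t" using k by (simp flip: power_add)
      then show ?thesis using zeta_mult_power[of "p ^ (k - t)" "p ^ t"] by (simp add: z_def)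
    qed
    have yj: "y ^ j = z ^ j * zeta (p ^ t) ^ (b' * j)" for j
    proof -
      have "y ^ j = z ^ j * (z ^ (p ^ (k - t))) ^ (b' * j)"
        unfolding y_def by (simp add: algebra_simps flip: power_mult power_add)
      then show ?thesis by (simp only: zk)
    qed
    have zt: "zeta (p ^ t) ^ (b' * j) = zeta (p ^ t) powi (b * r)" if "[int j = r] (mod int (p ^ t))" for j r
    proof -
      have "zeta (p ^ t) ^ (b' * j) = zeta (p ^ t) powi (b * int j)"
        by (simp add: b flip: of_nat_mult power_int_of_nat)
      also have "\<dots> = zeta (p ^ t) powi ((b * int j) mod int (p ^ t))"
        by (rule zeta_powi_mod[symmetric]) simp
      also have "(b * int j) mod int (p ^ t) = (b * r) mod int (p ^ t)"
        using cong_scalar_left[OF that, of b]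
        by (simp only: unique_euclidean_semiring_class.cong_def)
      also have "zeta (p ^ t) powi \<dots> = zeta (p ^ t) powi (b * r)"
        by (rule zeta_powi_mod) simp
      finally show ?thesis .
    qed
    have ym: "y ^ (p ^ m) = zeta p"
    proof -
      have "p ^ t dvd b' * p ^ m" using k by (simp add: le_imp_power_dvd)
      then have "zeta (p ^ t) ^ (b' * p ^ m) = 1" by (subst zeta_power_eq_1_iff) (use p_pos in auto)
      then show ?thesis by (simp add: yj zp)
    qed
    have "y ^ (p ^ Suc m) = (z ^ (p ^ Suc m)) ^ (1 + p ^ (k - t) * b')"
      unfolding y_def by (simp only: power_mult[symmetric] mult.commute)
    then have "y ^ (p ^ Suc m) = 1" by (simp only: root power_one)
    then have "prime_power_root p m y"
      using prime primitive ym zp by unfold_locales auto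
    then have "ieval P y = ieval Q y" using galois_conjugate PQ by blast
    then have "(\<Sum>x\<in>X. zeta p ^ e x * y ^ f x) = s * G ^ n * y ^ i"
      by (simp add: P ym Q_def ieval_half_prod_poly G_def s' mult_ac)
    moreover have "(\<Sum>x\<in>X. zeta p ^ e x * y ^ f x) =
        (\<Sum>x\<in>X. zeta p ^ e x * z ^ f x * zeta (p ^ t) powi (b * g x))"
      by (intro sum.cong refl) (simp add: yj zt[OF fg] mult_ac)
    moreover have "y ^ i = z ^ i * zeta (p ^ t) powi (b * (int i mod int (p ^ t)))"
      unfolding yj by (subst zt[of i "int i mod int (p ^ t)"])
        (auto simp: unique_euclidean_semiring_class.cong_def)
    ultimately show ?thesis by (simp add: mult_ac)
  qed
  have "int i mod int (p ^ t) \<in> Zmod (p ^ t)" unfolding mem_Zmod_iff by simp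
  then have "(\<Sum>x\<in>X. zeta p ^ e x * z ^ f x * \<phi> (g x)) = s * G ^ n * z ^ i * \<phi> (int i mod int (p ^ t))" for \<phi>
    by (intro fourier_separation[OF _ g _ twisted]) (use p_pos in auto)
  then show ?thesis using i(1) unfolding k(1) by (intro bexI[OF _ s] exI[of _ i] conjI allI)
qed

section \<open>Walsh-Hadamard transforms\<close>

lemma zeta_prime_power_powi:
  assumes "p > 0" "i \<le> k"
  shows "zeta (p ^ k) powi (int p ^ i * x) = zeta (p ^ (k - i)) powi x"
proof -
  have "p ^ k = p ^ i * p ^ (k - i)" using assms(2) by (simp flip: power_add)
  then show ?thesis using zeta_mult_powi[of "p ^ i" "p ^ (k - i)" x] assms(1) by simp
qed

text \<open>
  This and the next lemma express both transforms by the same summands, weighted with two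
  different functions of \<open>g\<close>.
\<close>

lemma walsh_hadamard_lift:
  assumes p: "p > 0" "t \<le> k" and f: "\<And>x. x \<in> vecs p n \<Longrightarrow> f x = g x + int p ^ t * h x"
  shows "walsh_hadamard p n k f u = complex_of_real (real p powr (- real n / 2)) *
    (\<Sum>x\<in>vecs p n. zeta p powi (- dotp n u x) * zeta (p ^ (k - t)) powi (h x) * zeta (p ^ k) powi (g x))"
proof -
  have "zeta p powi (- dotp n u x) * zeta (p ^ k) powi (f x) =
      zeta p powi (- dotp n u x) * zeta (p ^ (k - t)) powi (h x) * zeta (p ^ k) powi (g x)"
    if "x \<in> vecs p n" for x
    unfolding f[OF that] by (simp add: power_int_add zeta_prime_power_powi[OF p])
  then have "(\<Sum>x\<in>vecs p n. zeta p powi (- dotp n u x) * zeta (p ^ k) powi (f x)) =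
      (\<Sum>x\<in>vecs p n. zeta p powi (- dotp n u x) * zeta (p ^ (k - t)) powi (h x) * zeta (p ^ k) powi (g x))"
    by (rule sum.cong[OF refl])
  then show ?thesis by (simp only: walsh_hadamard_def)
qed

lemma walsh_hadamard_twist:
  assumes p: "p > 0" "2 * t \<le> k"
  shows "walsh_hadamard p n (k - t) (\<lambda>x. (h x + c * int p ^ (k - 2 * t) * g x) mod int (p ^ (k - t))) u =
    complex_of_real (real p powr (- real n / 2)) *
    (\<Sum>x\<in>vecs p n. zeta p powi (- dotp n u x) * zeta (p ^ (k - t)) powi (h x) * zeta (p ^ t) powi (c * g x))"
proof -
  have "zeta (p ^ (k - t)) powi ((h x + c * int p ^ (k - 2 * t) * g x) mod int (p ^ (k - t))) =
      zeta (p ^ (k - t)) powi (h x) * zeta (p ^ t) powi (c * g x)" for x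
  proof -
    have "zeta (p ^ (k - t)) powi ((h x + c * int p ^ (k - 2 * t) * g x) mod int (p ^ (k - t))) =
        zeta (p ^ (k - t)) powi (h x + int p ^ (k - 2 * t) * (c * g x))"
      using p(1) by (subst zeta_powi_mod) (auto simp: mult_ac)
    also have "\<dots> = zeta (p ^ (k - t)) powi (h x) * zeta (p ^ (k - t)) powi (int p ^ (k - 2 * t) * (c * g x))"
      by (rule power_int_add) simp
    also have "zeta (p ^ (k - t)) powi (int p ^ (k - 2 * t) * (c * g x)) = zeta (p ^ t) powi (c * g x)"
      using zeta_prime_power_powi[of p "k - 2 * t" "k - t" "c * g x"] p by simp
    finally show ?thesis .
  qed
  then show ?thesis unfolding walsh_hadamard_def by (simp only: mult.assoc)
qed

theorem theorem3p1:
  fixes p n k t :: nat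
    and a :: "nat \<Rightarrow> (nat \<Rightarrow> int) \<Rightarrow> int"
    and f g h :: "(nat \<Rightarrow> int) \<Rightarrow> int"
  assumes "prime p" and "odd p" and "n > 0" and "k > 0" and "t > 0" and "k \<ge> 2 * t"
    and "\<And>i. i \<in> {1..k} \<Longrightarrow> a i \<in> vecs p n \<rightarrow> Zmod p"
    and "\<And>x. x \<in> vecs p n \<Longrightarrow> f x = (\<Sum>i=1..k. int p ^ (i - 1) * a i x)"
    and "\<And>x. x \<in> vecs p n \<Longrightarrow> g x = (\<Sum>i=1..t. int p ^ (i - 1) * a i x)"
    and "\<And>x. x \<in> vecs p n \<Longrightarrow> h x = (\<Sum>i=1..k - t. int p ^ (i - 1) * a (t + i) x)"
  defines "hg \<equiv> \<lambda>c x. (h x + c * int p ^ (k - 2 * t) * g x) mod int (p ^ (k - t))"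
  shows "(\<forall>c\<in>Zmod (p ^ t). hg c \<in> GB p n (k - t)) \<and>
    (gbent p n k f \<longleftrightarrow>
      (\<forall>u\<in>vecs p n. \<exists>d\<in>Zmod (p ^ t). \<exists>j\<in>Zmod (p ^ (k - t)). \<exists>s\<in>{1, -1 :: complex}.
        \<forall>c\<in>Zmod (p ^ t).
          walsh_hadamard p n (k - t) (hg c) u =
            (if even n \<or> odd n \<and> p mod 4 = 1
             then s * zeta (p ^ (k - t)) powi j * zeta (p ^ t) powi (c * d)
             else s * \<i> * zeta (p ^ (k - t)) powi j * zeta (p ^ t) powi (c * d))))"
proof -
  let ?X = "vecs p n"
  let ?zk = "zeta (p ^ k)" and ?zt = "zeta (p ^ t)" and ?zkt = "zeta (p ^ (k - t))"
  define C where "C = complex_of_real (real p powr (- real n / 2))"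
  \<comment> \<open>the factor that distinguishes the two cases of the claim\<close>
  define \<kappa> :: complex where "\<kappa> = (if even n \<or> odd n \<and> p mod 4 = 1 then 1 else \<i>)"
  define \<omega> where "\<omega> u x = zeta p powi (- dotp n u x) * ?zkt powi (h x)" for u x
  have p0: "p > 0" using assms(1) prime_gt_0_nat by auto
  have tk: "t \<le> k" using assms(6) by simp
  have q0: "p ^ t > 0" using p0 by simp
  have aZ: "a i x \<in> Zmod p" if "i \<in> {1..k}" "x \<in> ?X" for i x
    using assms(7)[OF that(1)] that(2) by (rule Pi_mem)
  have gZ: "g x \<in> Zmod (p ^ t)" if "x \<in> ?X" for x
    unfolding assms(9)[OF that] using aZ that tk by (intro digit_sum_mem_Zmod) auto
  have fZ: "f x \<in> Zmod (p ^ k)" if "x \<in> ?X" for x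
    unfolding assms(8)[OF that] using aZ that by (intro digit_sum_mem_Zmod) auto
  have fgh: "f x = g x + int p ^ t * h x" if "x \<in> ?X" for x
    unfolding assms(8-10)[OF that] by (rule digit_sum_split[OF tk])
  have C0: "C \<noteq> 0" using p0 by (simp add: C_def)
  have Hf: "walsh_hadamard p n k f u = C * (\<Sum>x\<in>?X. \<omega> u x * ?zk powi (g x))" for u
    unfolding C_def \<omega>_def by (rule walsh_hadamard_lift[OF p0 tk fgh])
  have Hhg: "walsh_hadamard p n (k - t) (hg c) u = C * (\<Sum>x\<in>?X. \<omega> u x * ?zt powi (c * g x))" for c u
    unfolding C_def \<omega>_def hg_def by (rule walsh_hadamard_twist[OF p0 assms(6)])
  have goal_value: "(if even n \<or> odd n \<and> p mod 4 = 1
      then s * ?zkt powi j * ?zt powi (c * d) else s * \<i> * ?zkt powi j * ?zt powi (c * d)) =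
      s * \<kappa> * ?zkt powi j * ?zt powi (c * d)" for s j c d
    by (simp add: \<kappa>_def)
  have hgGB: "\<forall>c\<in>Zmod (p ^ t). hg c \<in> GB p n (k - t)"
    unfolding GB_def hg_def mem_Zmod_iff Pi_iff using p0 by simp
  have fGB: "f \<in> GB p n k" unfolding GB_def using fZ by blast
  have main: "norm (walsh_hadamard p n k f u) = 1 \<longleftrightarrow>
      (\<exists>d\<in>Zmod (p ^ t). \<exists>j\<in>Zmod (p ^ (k - t)). \<exists>s\<in>{1, -1 :: complex}. \<forall>c\<in>Zmod (p ^ t).
        walsh_hadamard p n (k - t) (hg c) u = s * \<kappa> * ?zkt powi j * ?zt powi (c * d))" for u
  proof
    assume "\<exists>d\<in>Zmod (p ^ t). \<exists>j\<in>Zmod (p ^ (k - t)). \<exists>s\<in>{1, -1 :: complex}. \<forall>c\<in>Zmod (p ^ t).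
        walsh_hadamard p n (k - t) (hg c) u = s * \<kappa> * ?zkt powi j * ?zt powi (c * d)"
    then obtain d j s where d: "d \<in> Zmod (p ^ t)" and s: "s \<in> {1, -1 :: complex}"
      and c: "\<And>c. c \<in> Zmod (p ^ t) \<Longrightarrow>
        C * (\<Sum>x\<in>?X. \<omega> u x * ?zt powi (c * g x)) = s * \<kappa> * ?zkt powi j * ?zt powi (c * d)"
      unfolding Hhg by blast
    let ?A = "s * \<kappa> * ?zkt powi j / C"
    have "(\<Sum>x\<in>?X. \<omega> u x * ?zk powi (g x)) = ?A * ?zk powi d"
    proof (rule fourier_separation[OF q0 gZ d])
      fix c assume "c \<in> Zmod (p ^ t)"
      then show "(\<Sum>x\<in>?X. \<omega> u x * ?zt powi (c * g x)) = ?A * ?zt powi (c * d)"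
        using c[of c] C0 by (simp add: field_simps)
    qed
    then have "walsh_hadamard p n k f u = s * \<kappa> * ?zkt powi j * ?zk powi d"
      unfolding Hf using C0 by simp
    moreover have "norm s = 1" "norm \<kappa> = 1" using s by (auto simp: \<kappa>_def)
    ultimately show "norm (walsh_hadamard p n k f u) = 1" by (simp add: norm_mult)
  next
    assume one: "norm (walsh_hadamard p n k f u) = 1"
    \<comment> \<open>natural exponents, as required for polynomials in z\<close>
    define e where "e x = nat ((- dotp n u x) mod int p)" for x
    let ?f = "\<lambda>x. nat (f x)"
    have e: "zeta p ^ e x = zeta p powi (- dotp n u x)" for x
      unfolding e_def by (rule zeta_powi_eq_power[OF p0, symmetric])
    have f: "?zk ^ ?f x = ?zk powi (f x)" "int (?f x) = f x" if "x \<in> ?X" for x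
      using fZ[OF that] unfolding mem_Zmod_iff by (auto simp: power_int_nonneg_exp)
    define S where "S = (\<Sum>x\<in>?X. zeta p ^ e x * ?zk ^ ?f x)"
    have "walsh_hadamard p n k f u = C * S"
      unfolding walsh_hadamard_def C_def S_def by (simp add: e f)
    then have "norm C * norm S = 1" using one by (simp add: norm_mult)
    then have "norm C ^ 2 * norm S ^ 2 = 1" by (simp flip: power_mult_distrib)
    moreover have "norm C ^ 2 * real p ^ n = 1"
    proof -
      have "norm C ^ 2 = real p powr (- real n)"
        using p0 by (simp add: C_def power2_eq_square flip: powr_add)
      then show ?thesis using p0 by (simp add: powr_minus powr_realpow)
    qed
    ultimately have "norm C ^ 2 * norm S ^ 2 = norm C ^ 2 * real p ^ n" by simp
    then have normS: "norm S ^ 2 = real p ^ n" using C0 by simp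
    obtain m where m: "k = Suc m" using assms(4) by (cases k) auto
    have tm: "t \<le> m" using assms(5,6) m by simp
    have fg: "[int (?f x) = g x] (mod int (p ^ t))" if "x \<in> ?X" for x
      unfolding f(2)[OF that] unfolding fgh[OF that] by (simp add: unique_euclidean_semiring_class.cong_def)
    obtain s0 i where s0: "s0 \<in> {1, -1}" and i: "i < p ^ k"
      and sep: "\<And>\<phi>. (\<Sum>x\<in>?X. zeta p ^ e x * ?zk ^ ?f x * \<phi> (g x)) =
        s0 * half_prod p (zeta p) ^ n * ?zk ^ i * \<phi> (int i mod int (p ^ t))"
      using unimodular_walsh_sum[OF assms(1,2) m tm gZ fg normS[unfolded S_def]] by blast
    have "prime_power_root p 0 (zeta p)" using prime_power_root_zeta[OF assms(1), of 0] by simp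
    then have "half_prod p (zeta p) ^ 2 = (- 1) ^ ((p - 1) div 2) * of_nat p"
      using prime_power_root.half_prod_square assms(2) by blast
    then obtain s1 where s1_mem: "s1 \<in> {1, -1}" and "C * half_prod p (zeta p) ^ n =
        (if even n \<or> odd n \<and> p mod 4 = 1 then s1 else s1 * \<i>)"
      using normalized_half_prod[OF _ assms(2)] unfolding C_def by blast
    then have s1: "s1 \<in> {1, -1}" "C * half_prod p (zeta p) ^ n = s1 * \<kappa>"
      by (simp_all add: \<kappa>_def)
    \<comment> \<open>the digits of i above and below position t give j and d\<close>
    define d where "d = int i mod int (p ^ t)"
    define j where "j = int (i div p ^ t)"
    have dZ: "d \<in> Zmod (p ^ t)" unfolding d_def mem_Zmod_iff using q0 by simp
    have "p ^ k = p ^ (k - t) * p ^ t" using tk by (simp flip: power_add)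
    then have jZ: "j \<in> Zmod (p ^ (k - t))"
      using i less_mult_imp_div_less[of i "p ^ (k - t)" "p ^ t"] unfolding j_def mem_Zmod_iff by simp
    have ij: "?zk ^ i * ?zk powi (- d) = ?zkt powi j"
    proof -
      have "int i - d = int p ^ t * j"
        unfolding d_def j_def by (simp add: zdiv_int minus_mod_eq_mult_div)
      then have "?zk powi (int i - d) = ?zkt powi j" using zeta_prime_power_powi[OF p0 tk] by simp
      then show ?thesis by (simp add: power_int_diff power_int_minus field_simps)
    qed
    have "walsh_hadamard p n (k - t) (hg c) u = s0 * s1 * \<kappa> * ?zkt powi j * ?zt powi (c * d)" for c
    proof -
      \<comment> \<open>the weight on the values of g that turns the summand of f into that of hg c\<close>
      have "\<omega> u x * ?zt powi (c * g x) = zeta p ^ e x * ?zk ^ ?f x * (?zk powi (- g x) * ?zt powi (c * g x))"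
        if "x \<in> ?X" for x
      proof -
        have "?zk ^ ?f x * ?zk powi (- g x) = ?zk powi (int p ^ t * h x)"
          unfolding f(1)[OF that] using fgh[OF that] by (simp flip: power_int_add)
        also have "\<dots> = ?zkt powi (h x)" by (rule zeta_prime_power_powi[OF p0 tk])
        finally show ?thesis by (simp add: \<omega>_def e mult_ac)
      qed
      then have "(\<Sum>x\<in>?X. \<omega> u x * ?zt powi (c * g x)) =
          (\<Sum>x\<in>?X. zeta p ^ e x * ?zk ^ ?f x * (?zk powi (- g x) * ?zt powi (c * g x)))"
        by (rule sum.cong[OF refl])
      then have "walsh_hadamard p n (k - t) (hg c) u =
          C * (\<Sum>x\<in>?X. zeta p ^ e x * ?zk ^ ?f x * (?zk powi (- g x) * ?zt powi (c * g x)))"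
        by (simp only: Hhg)
      also have "\<dots> = C * (s0 * half_prod p (zeta p) ^ n * ?zk ^ i * (?zk powi (- d) * ?zt powi (c * d)))"
        unfolding d_def by (simp only: sep[of "\<lambda>v. ?zk powi (- v) * ?zt powi (c * v)"])
      also have "\<dots> = s0 * (C * half_prod p (zeta p) ^ n) * (?zk ^ i * ?zk powi (- d)) * ?zt powi (c * d)"
        by (simp only: mult_ac)
      also have "\<dots> = s0 * s1 * \<kappa> * ?zkt powi j * ?zt powi (c * d)"
        unfolding ij s1(2) by (simp only: mult_ac)
      finally show ?thesis .
    qed
    moreover have "s0 * s1 \<in> {1, -1}" using s0 s1(1) by auto
    ultimately show "\<exists>d\<in>Zmod (p ^ t). \<exists>j\<in>Zmod (p ^ (k - t)). \<exists>s\<in>{1, -1 :: complex}. \<forall>c\<in>Zmod (p ^ t).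
        walsh_hadamard p n (k - t) (hg c) u = s * \<kappa> * ?zkt powi j * ?zt powi (c * d)"
      using dZ jZ by blast
  qed
  show ?thesis
    unfolding gbent_def goal_value using hgGB fGB main by blast
qed

end
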